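(* Consider the changepoint double array described in the context. Suppose (post-change separation) that $F_{P_0}$ and $H$ are continuous, $H(0)=0$, and $\sup_{t\in[0,1]}|H(t)-t|>0$. Suppose also (local KL support) that $H\ll U$ with $h:=dH/dU$ and $D_{\mathrm{KL}}(H\|U)=\int_0^1\log h\,dH\in(0,\infty)$, that $\phi:=\log h$ is bounded and Lipschitz, and that there are constants $a,c\ge0$ such that for every $r\ge1$ and all $z_1,\dots,z_r\in[0,1]$, $$\log\int_\Theta\prod_{i=1}^rf_\theta(z_i)\,d\Pi(\theta)\ge\sum_{i=1}^r\log h(z_i)-a\log r-c.$$ Let $w_k\propto k^{-(1+\eta)}$ with $\eta>0$ and $0<\sum_{k\ge1}w_k\le1$, and fix $\alpha\in(0,1)$. Then for every $A>(1+\eta)/D_{\mathrm{KL}}(H\|U)$, $$\mathbb P_{P_0,T_n,P_1}\{\tau_{n,Z,w}(1/\alpha)\le T_n+A\log T_n\}\to1,$$ $$\liminf_{n\to\infty}\mathbb P_{P_0,T_n,P_1}\{T_n<\tau_{n,Z,w}(1/\alpha)\le T_n+A\log T_n\}\ge1-\alpha,$$ $$\mathbb P_{P_0,T_n,P_1}\{\tau_{n,Z,w}(1/\alpha)>T_n+A\log T_n\mid\tau_{n,Z,w}(1/\alpha)>T_n\}\to0,$$ and all of these conclusions also hold with $\tau_{n,S,w}(1/\alpha)$ in place of $\tau_{n,Z,w}(1/\alpha)$.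
   Context: Data: $(T_n)_{n\ge1}$ is an increasing sequence of positive integers with $T_n\to\infty$; $P_0,P_1$ are probability measures on $\mathbb R$. For each $n$, the row $(X_{n,j})_{j\ge1}$ satisfies $X_{n,1},\dots,X_{n,T_n}\stackrel{iid}{\sim}P_0$, $X_{n,T_n+1},X_{n,T_n+2},\dots\stackrel{iid}{\sim}P_1$, the two blocks being independent; randomizers $\lambda_{n,j}\stackrel{iid}{\sim}U(0,1)$ are independent of the array. $\mathbb P_{P_0,T_n,P_1}$ is the law of row $n$ together with its randomizers. Conformal p-values: $p_{n,j}:=\frac1j\big(\sum_{i=1}^j\mathbf 1\{X_{n,i}<X_{n,j}\}+\lambda_{n,j}\sum_{i=1}^j\mathbf 1\{X_{n,i}=X_{n,j}\}\big)$. Detectors: $\mathcal F=\{f_\theta:\theta\in\Theta\}$ is a jointly measurable family of probability densities on $[0,1]$, $\Pi$ a probability measure on $\Theta$. For $k\le t$, $M_{n,k,t}:=\int_\Theta\prod_{j=k}^t f_\theta(p_{n,j})\,d\Pi(\theta)$, $S_{n,t}^{(w)}:=\sum_{k=1}^tw_kM_{n,k,t}$, $Z_{n,t}^{(w)}:=\max_{1\le k\le t}w_kM_{n,k,t}$, $\tau_{n,S,w}(b):=\inf\{t\ge1:S_{n,t}^{(w)}\ge b\}$, $\tau_{n,Z,w}(b):=\inf\{t\ge1:Z_{n,t}^{(w)}\ge b\}$ ($\inf\varnothing=\infty$). $F_{P_0}$ is the CDF of $P_0$ and $H(t):=\mathbb P_{Y\sim P_1}\{F_{P_0}(Y)\le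 t\}$, $t\in[0,1]$. $H$ also denotes the law with this CDF, and $U$ is the uniform law on $[0,1]$. *)

theory Defs
  imports "HOL-Probability.Probability"
begin

(* The uniform law is carried by the closed unit interval rather than by the whole real line.
   The end points are null, and p-values built from randomizers in [0,1] lie in [0,1] at every
   sample point, which is where the detector densities are defined and measurable. *)
definition unif01 :: "real measure" where
  "unif01 = restrict_space lborel {0..1}"

(* A sample point of row n is a pair (x, l): x j is the observation X_{n,j} and l j the randomizer
   lambda_{n,j}, both indexed by j >= 1. The argument T is the changepoint T_n. *)
definition row_law :: "real measure \<Rightarrow> nat \<Rightarrow> real measure \<Rightarrow> ((nat \<Rightarrow> real) \<times> (nat \<Rightarrow> real)) measure" where
  "row_law P0 T P1 =
     (\<Pi>\<^sub>M j\<in>{1..}. if j \<le> T then P0 else P1) \<Otimes>\<^sub>M (\<Pi>\<^sub>M j\<in>{1..}. unif01)"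

definition conf_pval :: "(nat \<Rightarrow> real) \<times> (nat \<Rightarrow> real) \<Rightarrow> nat \<Rightarrow> real" where
  "conf_pval \<omega> j = (case \<omega> of (x, l) \<Rightarrow>
     1 / real j * ((\<Sum>i=1..j. of_bool (x i < x j)) + l j * (\<Sum>i=1..j. of_bool (x i = x j))))"

(* Mixtures of products of densities may be infinite at some sample points, hence ennreal. *)
definition mix_lik :: "'t measure \<Rightarrow> ('t \<Rightarrow> real \<Rightarrow> real) \<Rightarrow> nat \<Rightarrow> nat \<Rightarrow> (nat \<Rightarrow> real) \<Rightarrow> ennreal" where
  "mix_lik Q f k t p = (\<integral>\<^sup>+\<theta>. (\<Prod>j=k..t. ennreal (f \<theta> (p j))) \<partial>Q)"

definition S_stat :: "'t measure \<Rightarrow> ('t \<Rightarrow> real \<Rightarrow> real) \<Rightarrow> (nat \<Rightarrow> real) \<Rightarrow> (nat \<Rightarrow> real) \<Rightarrow> nat \<Rightarrow> ennreal" where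
  "S_stat Q f w p t = (\<Sum>k=1..t. ennreal (w k) * mix_lik Q f k t p)"

definition Z_stat :: "'t measure \<Rightarrow> ('t \<Rightarrow> real \<Rightarrow> real) \<Rightarrow> (nat \<Rightarrow> real) \<Rightarrow> (nat \<Rightarrow> real) \<Rightarrow> nat \<Rightarrow> ennreal" where
  "Z_stat Q f w p t = Max ((\<lambda>k. ennreal (w k) * mix_lik Q f k t p) ` {1..t})"

(* The infimum of the empty set in enat is infinity. *)
definition first_passage :: "(nat \<Rightarrow> ennreal) \<Rightarrow> real \<Rightarrow> enat" where
  "first_passage s b = (INF t\<in>{t. 1 \<le> t \<and> ennreal b \<le> s t}. enat t)"

definition tau_S :: "'t measure \<Rightarrow> ('t \<Rightarrow> real \<Rightarrow> real) \<Rightarrow> (nat \<Rightarrow> real) \<Rightarrow> real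
    \<Rightarrow> (nat \<Rightarrow> real) \<times> (nat \<Rightarrow> real) \<Rightarrow> enat" where
  "tau_S Q f w b \<omega> = first_passage (S_stat Q f w (conf_pval \<omega>)) b"

definition tau_Z :: "'t measure \<Rightarrow> ('t \<Rightarrow> real \<Rightarrow> real) \<Rightarrow> (nat \<Rightarrow> real) \<Rightarrow> real
    \<Rightarrow> (nat \<Rightarrow> real) \<times> (nat \<Rightarrow> real) \<Rightarrow> enat" where
  "tau_Z Q f w b \<omega> = first_passage (Z_stat Q f w (conf_pval \<omega>)) b"

definition density_family :: "'t measure \<Rightarrow> ('t \<Rightarrow> real \<Rightarrow> real) \<Rightarrow> bool" where
  "density_family Q f \<longleftrightarrow>
     (\<lambda>(\<theta>, z). f \<theta> z) \<in> borel_measurable (Q \<Otimes>\<^sub>M unif01) \<and>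
     (\<forall>\<theta>\<in>space Q. (\<forall>z\<in>{0..1}. 0 \<le> f \<theta> z) \<and> (\<integral>\<^sup>+z. ennreal (f \<theta> z) \<partial>unif01) = 1)"

(* H as a function: the CDF of F_{P0}(Y) for Y distributed as P1. *)
definition pit_cdf :: "real measure \<Rightarrow> real measure \<Rightarrow> real \<Rightarrow> real" where
  "pit_cdf P0 P1 t = \<P>(y in P1. cdf P0 y \<le> t)"

(* H as a law on [0,1]. *)
definition pit_law :: "real measure \<Rightarrow> real measure \<Rightarrow> real measure" where
  "pit_law P0 P1 = distr P1 unif01 (cdf P0)"

(* Logarithm with the conventions log 0 = -infinity and log infinity = infinity. *)
definition ln_ennreal :: "ennreal \<Rightarrow> ereal" where
  "ln_ennreal x = (if x = 0 then -\<infinity> else if x = \<infinity> then \<infinity> else ereal (ln (enn2real x)))"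

end

theory Submission
  imports Defs "HOL-Real_Asymp.Real_Asymp"
begin

text \<open>
  Before the change the conformal p-values are i.i.d. uniform, so the weighted mixture together with the
  weights not yet used is a nonnegative martingale started below 1, and Ville's inequality
  bounds the probability of an alarm up to the changepoint by \<open>\<alpha>\<close>.

  After the change, with \<open>r \<approx> A log T\<close>, the p-values at times \<open>T + 1, \<dots>, T + r\<close> are close in mean to the
  i.i.d. variables \<open>F(X\<^sub>j)\<close> of law \<open>H\<close>: conditionally on \<open>X\<^sub>j\<close> and its randomizer, the error is a centred
  average over the \<open>T\<close> pre-change observations, plus at most \<open>r / T\<close>. As \<open>log h\<close> is Lipschitz, the
  summed log-likelihood ratio is about \<open>r D\<close>, which beats the price \<open>(1 + \<eta>) log T\<close> of the weight
  \<open>w\<^bsub>T + 1\<^esub>\<close> and the remainder \<open>a log r + c\<close>.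
\<close>

subsection \<open>The mixture statistic under uniform p-values\<close>

text \<open>Two obstacles shape the argument. Before the change, uniformity of each single p-value
  is not enough: the alarm event involves all of them, and they are computed from shared data. What
  decouples them is that the rank of a new observation among exchangeable ones is independent of the
  order of the earlier ones. After the change the p-values are dependent, because all are ranked
  against the same pre-change sample, so no law of large numbers is applied to them. Each is
  compared with its own F(X_j) in mean absolute error, and these errors add up by linearity of
  expectation; only the sum of the log h(F(X_j)) is treated as a sum of independent terms. Markov's
  inequality then suffices, and it asks of \<open>r\<close> only that it diverge and be of smaller
  order than \<open>T\<close>.

  The false alarm bound is proved for the larger statistic \<open>S_stat\<close>, the detection
  bound rests on the smaller \<open>Z_stat\<close>; every statistic between them inherits both, so
  the two detectors are treated together.\<close>

lemma space_unif01 [simp]: "space unif01 = {0..1}"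
  by (simp add: unif01_def space_restrict_space)

lemma prob_space_unif01: "prob_space unif01"
  by (rule prob_spaceI) (simp add: unif01_def space_restrict_space emeasure_restrict_space)

text \<open>Optional stopping, by induction on the number of coordinates. Conditional expectation
  given the past is the integral over the newest coordinate, so \<open>super\<close> is the
  supermartingale property and \<open>adapted\<close> replaces a filtration. By
  \<open>adapted\<close>, \<open>N 0\<close> is constant, which makes \<open>undefined\<close> a
  harmless argument.\<close>

lemma ville_PiM:
  fixes U :: "'a measure" and N :: "nat \<Rightarrow> (nat \<Rightarrow> 'a) \<Rightarrow> ennreal" and b :: ennreal
  assumes U: "prob_space U"
    and N_meas: "\<And>t. t \<le> n \<Longrightarrow> N t \<in> borel_measurable (PiM {1..t} (\<lambda>_. U))"
    and adapted: "\<And>t p q. t \<le> n \<Longrightarrow> (\<And>j. j \<in> {1..t} \<Longrightarrow> p j = q j) \<Longrightarrow> N t p = N t q"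
    and super: "\<And>t p. t < n \<Longrightarrow> p \<in> space (PiM {1..t} (\<lambda>_. U)) \<Longrightarrow>
                  (\<integral>\<^sup>+y. N (Suc t) (p(Suc t := y)) \<partial>U) \<le> N t p"
  shows "b * emeasure (PiM {1..n} (\<lambda>_. U))
           {p \<in> space (PiM {1..n} (\<lambda>_. U)). \<exists>t\<in>{1..n}. b \<le> N t p} \<le> N 0 undefined"
proof -
  interpret U: prob_space U by fact
  interpret product_sigma_finite "\<lambda>_::nat. U" ..
  \<comment> \<open>From the first hit on, \<open>G\<close> is frozen at \<open>b\<close> rather
    than at the value of \<open>N\<close>. Before the hit it equals \<open>N\<close>, at the hit it
    can only drop below \<open>N\<close>, so its mean cannot grow; and at time \<open>n\<close> it
    dominates \<open>b\<close> times the indicator of the hitting event.\<close>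
  define G where "G t p = (if \<exists>s\<in>{1..t}. b \<le> N s p then b else N t p)" for t p
  have N_meas': "N s \<in> borel_measurable (PiM {1..t} (\<lambda>_. U))" if "s \<le> t" "t \<le> n" for s t
  proof -
    have "(\<lambda>p. N s (restrict p {1..s})) \<in> borel_measurable (PiM {1..t} (\<lambda>_. U))"
      using that by (intro measurable_compose[OF measurable_restrict_subset N_meas]) auto
    also have "(\<lambda>p. N s (restrict p {1..s})) = N s"
      using that by (intro ext adapted) auto
    finally show ?thesis .
  qed
  have hit_meas: "Measurable.pred (PiM {1..t} (\<lambda>_. U)) (\<lambda>p. \<exists>s\<in>{1..t}. b \<le> N s p)"
    if "t \<le> n" for t
  proof -
    have [measurable]: "N s \<in> borel_measurable (PiM {1..t} (\<lambda>_. U))" if "s \<in> {1..t}" for s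
      using that \<open>t \<le> n\<close> by (intro N_meas') auto
    show ?thesis by measurable
  qed
  have G_meas: "G t \<in> borel_measurable (PiM {1..t} (\<lambda>_. U))" if "t \<le> n" for t
    unfolding G_def[abs_def] using hit_meas[OF that] N_meas[OF that] by measurable
  have bound: "(\<integral>\<^sup>+p. G t p \<partial>PiM {1..t} (\<lambda>_. U)) \<le> N 0 undefined" if "t \<le> n" for t
    using that
  proof (induction t)
    case 0
    have "N 0 (\<lambda>_. undefined) = N 0 undefined" by (rule adapted) auto
    then show ?case by (simp add: nn_integral_empty G_def)
  next
    case (Suc t)
    have G_step: "(\<integral>\<^sup>+y. G (Suc t) (p(Suc t := y)) \<partial>U) \<le> G t p"
      if p: "p \<in> space (PiM {1..t} (\<lambda>_. U))" for p
    proof -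
      have eq: "N s (p(Suc t := y)) = N s p" if "s \<le> t" for s y
        using that Suc.prems by (intro adapted) auto
      show ?thesis
      proof (cases "\<exists>s\<in>{1..t}. b \<le> N s p")
        case True
        then have "G (Suc t) (p(Suc t := y)) = b" for y
          unfolding G_def using eq by (metis atLeastAtMost_iff le_SucI)
        with True show ?thesis by (simp add: G_def U.emeasure_space_1)
      next
        case False
        have "G (Suc t) (p(Suc t := y)) \<le> N (Suc t) (p(Suc t := y))" for y
          using False eq unfolding G_def by (auto simp: le_Suc_eq)
        then have "(\<integral>\<^sup>+y. G (Suc t) (p(Suc t := y)) \<partial>U)
            \<le> (\<integral>\<^sup>+y. N (Suc t) (p(Suc t := y)) \<partial>U)"
          by (intro nn_integral_mono)
        also have "\<dots> \<le> N t p" using super p Suc.prems by simp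
        finally show ?thesis using False by (auto simp: G_def)
      qed
    qed
    have ins: "{1..Suc t} = insert (Suc t) {1..t}" by auto
    have "(\<integral>\<^sup>+p. G (Suc t) p \<partial>PiM {1..Suc t} (\<lambda>_. U))
        = (\<integral>\<^sup>+p. \<integral>\<^sup>+y. G (Suc t) (p(Suc t := y)) \<partial>U \<partial>PiM {1..t} (\<lambda>_. U))"
      using G_meas[OF Suc.prems] unfolding ins by (subst product_nn_integral_insert) auto
    also have "\<dots> \<le> (\<integral>\<^sup>+p. G t p \<partial>PiM {1..t} (\<lambda>_. U))"
      by (intro nn_integral_mono G_step)
    also have "\<dots> \<le> N 0 undefined" using Suc by simp
    finally show ?case .
  qed
  let ?A = "{p \<in> space (PiM {1..n} (\<lambda>_. U)). \<exists>t\<in>{1..n}. b \<le> N t p}"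
  have "b * emeasure (PiM {1..n} (\<lambda>_. U)) ?A = (\<integral>\<^sup>+p. b * indicator ?A p \<partial>PiM {1..n} (\<lambda>_. U))"
    using hit_meas[of n] by (subst nn_integral_cmult_indicator) auto
  also have "\<dots> \<le> (\<integral>\<^sup>+p. G n p \<partial>PiM {1..n} (\<lambda>_. U))"
    by (intro nn_integral_mono) (auto simp: G_def indicator_def)
  also have "\<dots> \<le> N 0 undefined" by (rule bound) simp
  finally show ?thesis .
qed

section \<open>Measurability and one-step means of the mixture statistics\<close>

lemma mix_lik_cong:
  "(\<And>j. j \<in> {k..t} \<Longrightarrow> p j = q j) \<Longrightarrow> mix_lik Q f k t p = mix_lik Q f k t q"
  unfolding mix_lik_def by (intro nn_integral_cong prod.cong) auto

lemma S_stat_cong: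
  "(\<And>j. j \<in> {1..t} \<Longrightarrow> p j = q j) \<Longrightarrow> S_stat Q f w p t = S_stat Q f w q t"
  unfolding S_stat_def by (intro sum.cong arg_cong2[where f="(*)"] mix_lik_cong) auto

lemma borel_measurable_mix_lik:
  assumes "prob_space Q" "density_family Q f" "{k..t} \<subseteq> I"
  shows "mix_lik Q f k t \<in> borel_measurable (PiM I (\<lambda>_. unif01))"
proof -
  interpret Q: prob_space Q by fact
  have f: "(\<lambda>(\<theta>, z). f \<theta> z) \<in> borel_measurable (Q \<Otimes>\<^sub>M unif01)"
    using assms by (simp add: density_family_def)
  have [measurable]: "(\<lambda>x. f (snd x) (fst x j)) \<in> borel_measurable (PiM I (\<lambda>_. unif01) \<Otimes>\<^sub>M Q)"
    if "j \<in> {k..t}" for j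
  proof -
    have "(\<lambda>x. (snd x, fst x j)) \<in> PiM I (\<lambda>_. unif01) \<Otimes>\<^sub>M Q \<rightarrow>\<^sub>M Q \<Otimes>\<^sub>M unif01"
      using that assms(3) by (auto intro!: measurable_Pair measurable_snd measurable_compose[OF measurable_fst])
    from measurable_compose[OF this f] show ?thesis by simp
  qed
  show ?thesis
    unfolding mix_lik_def[abs_def]
    by (rule Q.borel_measurable_nn_integral) (simp add: case_prod_beta)
qed

lemma borel_measurable_S_stat:
  assumes "prob_space Q" "density_family Q f" "{1..t} \<subseteq> I"
  shows "(\<lambda>p. S_stat Q f w p t) \<in> borel_measurable (PiM I (\<lambda>_. unif01))"
  unfolding S_stat_def using assms
  by (intro borel_measurable_sum borel_measurable_times_ennreal borel_measurable_const
      borel_measurable_mix_lik) auto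

lemma borel_measurable_Z_stat:
  assumes "prob_space Q" "density_family Q f" "{1..t} \<subseteq> I"
  shows "(\<lambda>p. Z_stat Q f w p t) \<in> borel_measurable (PiM I (\<lambda>_. unif01))"
proof (cases "t = 0")
  case False
  have "Z_stat Q f w p t = (SUP k\<in>{1..t}. ennreal (w k) * mix_lik Q f k t p)" for p
    using False unfolding Z_stat_def by (subst Max_Sup) auto
  moreover have "(\<lambda>p. SUP k\<in>{1..t}. ennreal (w k) * mix_lik Q f k t p)
      \<in> borel_measurable (PiM I (\<lambda>_. unif01))"
    using assms by (intro borel_measurable_SUP borel_measurable_times_ennreal borel_measurable_const
      borel_measurable_mix_lik) auto
  ultimately show ?thesis by simp
qed (simp add: Z_stat_def)

text \<open>Tonelli moves the integral over the new p-value inside, where it removes one density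
  factor of mass 1. In the case \<open>k = Suc t\<close> the product on the right is empty and the
  new candidate contributes the mass of \<open>Q\<close>. The range condition on \<open>p\<close> is
  there because the densities are measurable on [0,1] only.\<close>

lemma nn_integral_mix_lik_step:
  assumes "prob_space Q" "density_family Q f" "k \<le> Suc t" "\<And>j. j \<in> {k..t} \<Longrightarrow> p j \<in> {0..1}"
  shows "(\<integral>\<^sup>+y. mix_lik Q f k (Suc t) (p(Suc t := y)) \<partial>unif01) = mix_lik Q f k t p"
proof -
  interpret Q: prob_space Q by fact
  interpret U: prob_space unif01 by (rule prob_space_unif01)
  interpret pair_sigma_finite unif01 Q ..
  have f: "(\<lambda>(\<theta>, z). f \<theta> z) \<in> borel_measurable (Q \<Otimes>\<^sub>M unif01)"
    and f1: "\<And>\<theta>. \<theta> \<in> space Q \<Longrightarrow> (\<integral>\<^sup>+z. ennreal (f \<theta> z) \<partial>unif01) = 1"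
    using assms by (auto simp: density_family_def)
  have fj [measurable]: "(\<lambda>\<theta>. f \<theta> (p j)) \<in> borel_measurable Q" if "j \<in> {k..t}" for j
    using measurable_compose[OF _ f, of "\<lambda>\<theta>. (\<theta>, p j)" Q] assms(4)[OF that] by simp
  have [measurable]: "(\<lambda>x. f (snd x) (fst x)) \<in> borel_measurable (unif01 \<Otimes>\<^sub>M Q)"
    using measurable_compose[OF measurable_pair_swap' f] by (simp add: case_prod_beta)
  have fz [measurable]: "f \<theta> \<in> borel_measurable unif01" if "\<theta> \<in> space Q" for \<theta>
    using measurable_compose[OF measurable_Pair1'[OF that] f] by simp
  have split: "(\<Prod>j=k..Suc t. ennreal (f \<theta> ((p(Suc t := y)) j)))
      = (\<Prod>j=k..t. ennreal (f \<theta> (p j))) * ennreal (f \<theta> y)" for \<theta> y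
  proof -
    have "(\<Prod>j=k..t. ennreal (f \<theta> ((p(Suc t := y)) j))) = (\<Prod>j=k..t. ennreal (f \<theta> (p j)))"
      by (intro prod.cong) auto
    then show ?thesis using assms(3) by (simp add: prod.nat_ivl_Suc')
  qed
  have "(\<integral>\<^sup>+y. mix_lik Q f k (Suc t) (p(Suc t := y)) \<partial>unif01)
      = (\<integral>\<^sup>+\<theta>. \<integral>\<^sup>+y. (\<Prod>j=k..t. ennreal (f \<theta> (p j))) * ennreal (f \<theta> y) \<partial>unif01 \<partial>Q)"
    unfolding mix_lik_def split by (subst Fubini') (auto simp: case_prod_beta)
  also have "\<dots> = (\<integral>\<^sup>+\<theta>. (\<Prod>j=k..t. ennreal (f \<theta> (p j))) \<partial>Q)"
    by (intro nn_integral_cong) (simp add: nn_integral_cmult f1)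
  finally show ?thesis by (simp add: mix_lik_def)
qed

lemma false_alarm_uniform:
  assumes "prob_space Q" "density_family Q f"
    and w: "\<And>k. 1 \<le> k \<Longrightarrow> 0 \<le> w k" "(\<Sum>k=1..n. w k) \<le> 1" and \<alpha>: "0 < \<alpha>"
  shows "emeasure (PiM {1..n} (\<lambda>_. unif01)) {p \<in> space (PiM {1..n} (\<lambda>_. unif01)).
           \<exists>t\<in>{1..n}. ennreal (1 / \<alpha>) \<le> S_stat Q f w p t} \<le> ennreal \<alpha>"
    (is "emeasure ?P ?A \<le> _")
proof -
  \<comment> \<open>The reserve of weights with \<open>k > t\<close> is cut off at the horizon
    \<open>n\<close>, so \<open>N 0\<close> is a finite sum of weights and at most 1. One time step
    moves \<open>w (Suc t)\<close> from the reserve into the mean of \<open>S_stat\<close>, an exact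
    balance.\<close>
  define N where "N t p = S_stat Q f w p t + (\<Sum>k=Suc t..n. ennreal (w k))" for t p
  let ?B = "{p \<in> space ?P. \<exists>t\<in>{1..n}. ennreal (1 / \<alpha>) \<le> N t p}"
  interpret U: prob_space unif01 by (rule prob_space_unif01)
  have N_meas: "N t \<in> borel_measurable (PiM I (\<lambda>_. unif01))" if "{1..t} \<subseteq> I" for t I
    unfolding N_def[abs_def] using that assms
    by (intro borel_measurable_add borel_measurable_S_stat borel_measurable_const) auto
  have "ennreal (1 / \<alpha>) * emeasure ?P ?B \<le> N 0 undefined"
  proof (rule ville_PiM[OF prob_space_unif01])
    show "N t p = N t q" if "t \<le> n" "\<And>j. j \<in> {1..t} \<Longrightarrow> p j = q j" for t p q
      using S_stat_cong[OF that(2)] by (simp add: N_def)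
    show "(\<integral>\<^sup>+y. N (Suc t) (p(Suc t := y)) \<partial>unif01) \<le> N t p"
      if "t < n" and p: "p \<in> space (PiM {1..t} (\<lambda>_. unif01))" for t p
    proof -
      have pj: "p j \<in> {0..1}" if "j \<in> {1..t}" for j
        using p that by (auto simp: space_PiM PiE_iff)
      have [measurable]: "(\<lambda>y. mix_lik Q f k (Suc t) (p(Suc t := y))) \<in> borel_measurable unif01"
        if "1 \<le> k" for k
      proof -
        have "(\<lambda>y. p(Suc t := y)) \<in> unif01 \<rightarrow>\<^sub>M PiM {1..Suc t} (\<lambda>_. unif01)"
          using p by (intro measurable_fun_upd[of _ "{1..t}"]) auto
        then show ?thesis
          using that assms by (intro measurable_compose[OF _ borel_measurable_mix_lik]) auto
      qed
      have "(\<integral>\<^sup>+y. S_stat Q f w (p(Suc t := y)) (Suc t) \<partial>unif01)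
          = (\<Sum>k=1..Suc t. ennreal (w k) * (\<integral>\<^sup>+y. mix_lik Q f k (Suc t) (p(Suc t := y)) \<partial>unif01))"
        unfolding S_stat_def by (subst nn_integral_sum) (auto simp: nn_integral_cmult)
      also have "\<dots> = (\<Sum>k=1..Suc t. ennreal (w k) * mix_lik Q f k t p)"
        using pj assms by (intro sum.cong arg_cong2[where f="(*)"] nn_integral_mix_lik_step) auto
      also have "\<dots> = S_stat Q f w p t + ennreal (w (Suc t))"
        using prob_space.emeasure_space_1[OF assms(1)] by (simp add: S_stat_def mix_lik_def)
      finally have "(\<integral>\<^sup>+y. N (Suc t) (p(Suc t := y)) \<partial>unif01)
          = S_stat Q f w p t + ennreal (w (Suc t)) + (\<Sum>k=Suc (Suc t)..n. ennreal (w k))"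
        unfolding N_def
        using U.emeasure_space_1 by (subst nn_integral_add) (auto simp: S_stat_def)
      also have "\<dots> = N t p"
        using \<open>t < n\<close> by (simp add: N_def sum.atLeast_Suc_atMost add.assoc)
      finally show ?thesis by simp
    qed
  qed (rule N_meas, simp)
  also have "N 0 undefined = ennreal (\<Sum>k=1..n. w k)"
    using w by (subst sum_ennreal[symmetric]) (auto simp: N_def S_stat_def)
  also have "\<dots> \<le> 1" using w by (simp add: ennreal_le_1)
  finally have "ennreal \<alpha> * (ennreal (1 / \<alpha>) * emeasure ?P ?B) \<le> ennreal \<alpha> * 1"
    by (intro mult_left_mono) auto
  then have "emeasure ?P ?B \<le> ennreal \<alpha>"
    using \<alpha> by (simp add: mult.assoc[symmetric] ennreal_mult[symmetric])
  moreover have "emeasure ?P ?A \<le> emeasure ?P ?B"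
  proof (rule emeasure_mono)
    have "S_stat Q f w p t \<le> N t p" for t p by (simp add: N_def)
    then show "?A \<subseteq> ?B" by (blast intro: order_trans)
    have [measurable]: "N t \<in> borel_measurable ?P" if "t \<in> {1..n}" for t
      using that by (intro N_meas) auto
    show "?B \<in> sets ?P" by measurable
  qed
  ultimately show ?thesis by simp
qed

subsection \<open>Conformal p-values of exchangeable data are uniform\<close>

lemma conf_pval_range:
  assumes "1 \<le> j" "l j \<in> {0..1}"
  shows "conf_pval (x, l) j \<in> {0..1}"
proof -
  let ?a = "\<Sum>i=1..j. of_bool (x i < x j) :: real" and ?b = "\<Sum>i=1..j. of_bool (x i = x j) :: real"
  have "?a + ?b = (\<Sum>i=1..j. of_bool (x i < x j) + of_bool (x i = x j))"
    by (simp add: sum.distrib)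
  also have "\<dots> \<le> (\<Sum>i=1..j. 1)" by (intro sum_mono) auto
  finally have ab: "?a + ?b \<le> real j" by simp
  have b0: "0 \<le> ?b" and a0: "0 \<le> ?a" by (auto intro: sum_nonneg)
  have "l j * ?b \<le> 1 * ?b" using assms b0 by (intro mult_right_mono) auto
  with ab have "?a + l j * ?b \<le> real j" by simp
  moreover have "0 \<le> ?a + l j * ?b" using a0 b0 assms by simp
  ultimately show ?thesis using assms(1) by (simp add: conf_pval_def field_simps)
qed

lemma conf_pval_cong:
  "(\<And>i. i \<in> {1..j} \<Longrightarrow> x i = x' i) \<Longrightarrow> l j = l' j \<Longrightarrow> 1 \<le> j \<Longrightarrow>
     conf_pval (x, l) j = conf_pval (x', l') j"
  unfolding conf_pval_def prod.case
  by (intro arg_cong2[where f="(*)"] arg_cong2[where f="(+)"] refl sum.cong) auto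

text \<open>The index \<open>Suc n\<close> always ties with itself, so in the absence of other ties
  the randomizer enters with coefficient exactly 1.\<close>

lemma conf_pval_no_ties:
  assumes "\<And>i. i \<in> {1..n} \<Longrightarrow> x i \<noteq> x (Suc n)"
  shows "conf_pval (x, l) (Suc n) = (real (card {i\<in>{1..n}. x i < x (Suc n)}) + l (Suc n)) / real (Suc n)"
proof -
  have "(\<Sum>i=1..n. of_bool (x i < x (Suc n)) :: real) = real (card {i\<in>{1..n}. x i < x (Suc n)})"
    by (simp add: of_bool_def sum.If_cases Int_def)
  moreover have "(\<Sum>i=1..n. of_bool (x i = x (Suc n)) :: real) = 0"
    using assms by (intro sum.neutral) auto
  ultimately show ?thesis by (simp add: conf_pval_def)
qed

text \<open>The restriction to \<open>J\<close> makes the vector extensional, hence a point of the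
  product space over \<open>J\<close>, where its law can be compared with the uniform
  product.\<close>

definition pvals :: "nat set \<Rightarrow> (nat \<Rightarrow> real) \<Rightarrow> (nat \<Rightarrow> real) \<Rightarrow> nat \<Rightarrow> real" where
  "pvals J x l = (\<lambda>j\<in>J. conf_pval (x, l) j)"

section \<open>Measurability of the p-value vector\<close>

lemma measurable_unif01I:
  "f \<in> borel_measurable M \<Longrightarrow> (\<And>x. x \<in> space M \<Longrightarrow> f x \<in> {0..1}) \<Longrightarrow> f \<in> M \<rightarrow>\<^sub>M unif01"
  unfolding unif01_def by (rule measurable_restrict_space2) auto

lemma measurable_component_borel:
  assumes "f \<in> N \<rightarrow>\<^sub>M PiM I M" "i \<in> I" "sets (M i) = sets borel"
  shows "(\<lambda>\<omega>. f \<omega> i) \<in> borel_measurable N"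
proof -
  have "(\<lambda>\<omega>. f \<omega> i) \<in> N \<rightarrow>\<^sub>M M i" using assms by measurable
  then show ?thesis using assms(3) measurable_cong_sets by blast
qed

lemma measurable_unif01_borel: "f \<in> N \<rightarrow>\<^sub>M unif01 \<Longrightarrow> f \<in> borel_measurable N"
  unfolding unif01_def measurable_restrict_space2_iff by simp

lemma borel_measurable_conf_pval:
  assumes x: "\<And>i. i \<in> {1..j} \<Longrightarrow> (\<lambda>\<omega>. x \<omega> i) \<in> borel_measurable N"
    and l: "(\<lambda>\<omega>. l \<omega> j) \<in> borel_measurable N" and "1 \<le> j"
  shows "(\<lambda>\<omega>. conf_pval (x \<omega>, l \<omega>) j) \<in> borel_measurable N"
proof -
  note [measurable] = l
  have [measurable]: "(\<lambda>\<omega>. x \<omega> i) \<in> borel_measurable N" if "i \<in> {1..j}" for i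
    using x[OF that] .
  have [measurable]: "(\<lambda>\<omega>. x \<omega> j) \<in> borel_measurable N" using x[of j] assms(3) by simp
  show ?thesis unfolding conf_pval_def prod.case of_bool_def by measurable
qed

lemma measurable_pvals:
  assumes x: "x \<in> N \<rightarrow>\<^sub>M PiM I M" and l: "l \<in> N \<rightarrow>\<^sub>M PiM J (\<lambda>_. unif01)"
    and J: "K \<subseteq> J" "\<And>j. j \<in> K \<Longrightarrow> 1 \<le> j \<and> {1..j} \<subseteq> I"
    and M: "\<And>i. i \<in> I \<Longrightarrow> sets (M i) = sets borel"
  shows "(\<lambda>\<omega>. pvals K (x \<omega>) (l \<omega>)) \<in> N \<rightarrow>\<^sub>M PiM K (\<lambda>_. unif01)"
  unfolding pvals_def
proof (rule measurable_restrict)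
  fix j assume j: "j \<in> K"
  have lj: "(\<lambda>\<omega>. l \<omega> j) \<in> N \<rightarrow>\<^sub>M unif01" using l j J(1) by (auto intro: measurable_compose)
  show "(\<lambda>\<omega>. conf_pval (x \<omega>, l \<omega>) j) \<in> N \<rightarrow>\<^sub>M unif01"
  proof (rule measurable_unif01I)
    show "(\<lambda>\<omega>. conf_pval (x \<omega>, l \<omega>) j) \<in> borel_measurable N"
      using J(2)[OF j] M measurable_unif01_borel[OF lj]
      by (intro borel_measurable_conf_pval measurable_component_borel[OF x]) auto
    show "conf_pval (x \<omega>, l \<omega>) j \<in> {0..1}" if "\<omega> \<in> space N" for \<omega>
      using J(2)[OF j] measurable_space[OF lj that] by (intro conf_pval_range) auto
  qed
qed

section \<open>Ranks in an exchangeable sample\<close>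

lemma ex1_rank:
  fixes x :: "'i \<Rightarrow> 'a :: linorder"
  assumes "finite I" "inj_on x I" "r < card I"
  shows "\<exists>!i. i \<in> I \<and> card {k\<in>I. x k < x i} = r"
proof -
  \<comment> \<open>\<open>R\<close> is strictly increasing in the value \<open>x i\<close>, hence
    injective on \<open>I\<close>; its values lie below \<open>card I\<close>, so by counting it
    takes each of them exactly once.\<close>
  define R where "R i = card {k\<in>I. x k < x i}" for i
  have less: "R i < R j" if "i \<in> I" "x i < x j" for i j
    unfolding R_def using that assms(1) by (intro psubset_card_mono) auto
  have inj: "inj_on R I"
  proof (rule inj_onI)
    fix i j assume ij: "i \<in> I" "j \<in> I" "R i = R j"
    then have "x i = x j" using less[of i j] less[of j i] by (metis less_irrefl neqE)
    then show "i = j" using assms(2) ij by (auto dest: inj_onD)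
  qed
  have "R i < card I" if "i \<in> I" for i
    unfolding R_def using that assms(1) by (intro psubset_card_mono) auto
  then have "R ` I = {..<card I}"
    using inj assms(1) by (intro card_subset_eq) (auto simp: card_image)
  with assms(3) inj show ?thesis unfolding R_def[symmetric]
    by (metis (no_types, lifting) imageE inj_onD lessThan_iff)
qed

text \<open>Integrate over coordinate \<open>j\<close> with the others fixed: a tie with
  \<open>i\<close> then asks for the single point \<open>x i\<close>, which is null. Only finitely
  many pairs have to be combined.\<close>

lemma AE_PiM_distinct:
  assumes P: "prob_space P" "sets P = sets borel" "\<And>x::real. measure P {x} = 0" and "finite I"
  shows "AE x in PiM I (\<lambda>_. P). inj_on x I"
proof -
  interpret P: prob_space P by fact
  interpret product_sigma_finite "\<lambda>_. P" ..
  have "AE x in PiM I (\<lambda>_. P). x i \<noteq> x j" if ij: "i \<in> I" "j \<in> I" "i \<noteq> j" for i j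
  proof (rule AE_I[where N="{x \<in> space (PiM I (\<lambda>_. P)). x i = x j}"])
    define K where "K = I - {j}"
    have I: "I = insert j K" "finite K" "j \<notin> K" "i \<in> K"
      using ij assms(4) by (auto simp: K_def)
    have [measurable]: "(\<lambda>x. x k) \<in> borel_measurable (PiM I (\<lambda>_. P))" if "k \<in> I" for k
      using P that by (intro measurable_component_borel[where f="\<lambda>x. x" and M="\<lambda>_. P" and I=I]) auto
    show S: "{x \<in> space (PiM I (\<lambda>_. P)). x i = x j} \<in> sets (PiM I (\<lambda>_. P))"
      using ij by measurable
    have "emeasure (PiM I (\<lambda>_. P)) {x \<in> space (PiM I (\<lambda>_. P)). x i = x j}
        = (\<integral>\<^sup>+x. indicator {x \<in> space (PiM I (\<lambda>_. P)). x i = x j} x \<partial>PiM I (\<lambda>_. P))"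
      using S by simp
    also have "\<dots> = (\<integral>\<^sup>+x. \<integral>\<^sup>+y. indicator {x \<in> space (PiM I (\<lambda>_. P)). x i = x j} (x(j := y)) \<partial>P \<partial>PiM K (\<lambda>_. P))"
      using S I unfolding I(1) by (subst product_nn_integral_insert) auto
    also have "\<dots> \<le> (\<integral>\<^sup>+x. \<integral>\<^sup>+y. indicator {x i} y \<partial>P \<partial>PiM K (\<lambda>_. P))"
      using ij(3) by (intro nn_integral_mono) (auto simp: indicator_def)
    also have "\<dots> = 0"
      using P(2,3) by (simp add: P.emeasure_eq_measure)
    finally show "emeasure (PiM I (\<lambda>_. P)) {x \<in> space (PiM I (\<lambda>_. P)). x i = x j} = 0" by simp
  qed auto
  then have "AE x in PiM I (\<lambda>_. P). \<forall>i\<in>I. \<forall>j\<in>I. i \<noteq> j \<longrightarrow> x i \<noteq> x j"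
    using assms(4) by (auto simp: AE_finite_all)
  then show ?thesis by eventually_elim (auto simp: inj_on_def)
qed

text \<open>Exchangeability: swapping the coordinates \<open>i\<close> and \<open>m\<close>
  preserves both the product law and \<open>s\<close>, and turns the rank of \<open>i\<close> into
  the rank of \<open>m\<close>, so all \<open>J i\<close> agree. Almost surely exactly one index has
  rank \<open>r\<close>, so they add up to the full integral of \<open>s\<close>. With
  \<open>s\<close> an arbitrary symmetric function this encodes independence, not just uniformity of
  the rank.\<close>

lemma nn_integral_rank:
  fixes s :: "(nat \<Rightarrow> real) \<Rightarrow> ennreal"
  assumes P: "prob_space P" "sets P = sets borel" "\<And>x::real. measure P {x} = 0"
    and s: "s \<in> borel_measurable (PiM {1..m} (\<lambda>_. P))"
    and sym: "\<And>x i j. i \<in> {1..m} \<Longrightarrow> j \<in> {1..m} \<Longrightarrow> s (restrict (x \<circ> Transposition.transpose i j) {1..m}) = s x"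
    and "r < m"
  shows "(\<integral>\<^sup>+x. s x * indicator {x. card {k\<in>{1..m}. x k < x m} = r} x \<partial>PiM {1..m} (\<lambda>_. P))
    = ennreal (1 / real m) * (\<integral>\<^sup>+x. s x \<partial>PiM {1..m} (\<lambda>_. P))"
proof -
  let ?M = "PiM {1..m} (\<lambda>_. P)"
  define R where "R x i = card {k\<in>{1..m}. x k < x i}" for x :: "nat \<Rightarrow> real" and i
  define J where "J i = (\<integral>\<^sup>+x. s x * indicator {x. R x i = r} x \<partial>?M)" for i
  have comp [measurable]: "(\<lambda>x. x k) \<in> borel_measurable ?M" if "k \<in> {1..m}" for k
    using P that by (intro measurable_component_borel[where f="\<lambda>x. x" and M="\<lambda>_. P" and I="{1..m}"]) auto
  note s[measurable]
  have Rm: "(\<lambda>x. indicator {x. R x i = r} x :: ennreal) \<in> borel_measurable ?M" if "i \<in> {1..m}" for i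
  proof -
    have *: "real (R x i) = (\<Sum>k\<in>{1..m}. of_bool (x k < x i))" for x
      by (simp add: R_def of_bool_def sum.If_cases Int_def)
    have [measurable]: "(\<lambda>x. x i) \<in> borel_measurable ?M" using \<open>i \<in> {1..m}\<close> by (rule comp)
    have "(\<lambda>x. real (R x i)) \<in> borel_measurable ?M" unfolding * by measurable
    then have "Measurable.pred ?M (\<lambda>x. real (R x i) = real r)" by measurable
    then show ?thesis by (simp add: indicator_def)
  qed
  have J_eq: "J i = J m" if i: "i \<in> {1..m}" for i
  proof -
    let ?t = "\<lambda>x. \<lambda>k\<in>{1..m}. x (Transposition.transpose i m k)"
    have d: "distr ?M ?M ?t = ?M"
      using i P(1) by (intro distr_PiM_reindex inj_on_subset[OF inj_transpose]) (auto simp: Transposition.transpose_def)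
    have tm: "?t \<in> ?M \<rightarrow>\<^sub>M ?M"
      using i by (intro measurable_restrict measurable_component_singleton) (auto simp: Transposition.transpose_def)
    have Rt: "R (?t x) m = R x i" for x :: "nat \<Rightarrow> real"
    proof -
      have "{k\<in>{1..m}. ?t x k < ?t x m} = Transposition.transpose i m ` {k\<in>{1..m}. x k < x i}"
        using i by (auto simp: image_iff Transposition.transpose_def split: if_splits)
      then show ?thesis unfolding R_def by (simp add: card_image)
    qed
    have "J m = (\<integral>\<^sup>+x. s x * indicator {x. R x m = r} x \<partial>distr ?M ?M ?t)"
      unfolding d J_def ..
    also have "\<dots> = (\<integral>\<^sup>+x. s (?t x) * indicator {x. R x m = r} (?t x) \<partial>?M)"
    proof (rule nn_integral_distr[OF tm])
      show "(\<lambda>x. s x * indicator {x. R x m = r} x) \<in> borel_measurable (distr ?M ?M ?t)"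
        unfolding measurable_distr_eq1 using i by (intro borel_measurable_times_ennreal s Rm) simp
    qed
    also have "\<dots> = J i"
      unfolding J_def
    proof (intro nn_integral_cong)
      fix x :: "nat \<Rightarrow> real"
      have "s (?t x) = s x" using sym[of i m x] i by (simp add: comp_def)
      then show "s (?t x) * indicator {x. R x m = r} (?t x) = s x * indicator {x. R x i = r} x"
        by (simp only: indicator_def mem_Collect_eq Rt[of x])
    qed
    finally show ?thesis by simp
  qed
  have "(\<Sum>i=1..m. J i) = (\<Sum>i=1..m. J m)" by (intro sum.cong J_eq refl)
  then have "of_nat m * J m = (\<Sum>i=1..m. J i)" by simp
  also have "\<dots> = (\<integral>\<^sup>+x. (\<Sum>i=1..m. s x * indicator {x. R x i = r} x) \<partial>?M)"
    unfolding J_def using Rm by (intro nn_integral_sum[symmetric] borel_measurable_times_ennreal s)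
  also have "\<dots> = (\<integral>\<^sup>+x. s x \<partial>?M)"
  proof (rule nn_integral_cong_AE)
    show "AE x in ?M. (\<Sum>i=1..m. s x * indicator {x. R x i = r} x) = s x"
      using AE_PiM_distinct[OF P finite_atLeastAtMost[of 1 m]]
    proof eventually_elim
      case (elim x)
      have "\<exists>!i. i \<in> {1..m} \<and> R x i = r"
        unfolding R_def by (rule ex1_rank[OF _ elim]) (use \<open>r < m\<close> in simp_all)
      then obtain i where i: "i \<in> {1..m} \<and> R x i = r"
        and uniq: "\<forall>j. j \<in> {1..m} \<and> R x j = r \<longrightarrow> j = i"
        by (rule ex1E)
      have "s x * indicator {x. R x j = r} x = (if i = j then s x else 0)" if "j \<in> {1..m}" for j
      proof (cases "i = j")
        case True
        then show ?thesis using i by simp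
      next
        case False
        then have "R x j \<noteq> r" using uniq that by blast
        then show ?thesis using False by simp
      qed
      then have "(\<Sum>j=1..m. s x * indicator {x. R x j = r} x) = (\<Sum>j=1..m. if i = j then s x else 0)"
        by (rule sum.cong[OF refl])
      also have "\<dots> = s x" using i[THEN conjunct1] by (simp only: sum.delta' finite_atLeastAtMost if_True)
      finally show ?case .
    qed
  qed
  finally have "ennreal (1 / real m) * (of_nat m * J m) = ennreal (1 / real m) * (\<integral>\<^sup>+x. s x \<partial>?M)"
    by simp
  moreover have "ennreal (1 / real m) * of_nat m = 1"
    using \<open>r < m\<close> by (simp add: ennreal_of_nat_eq_real_of_nat ennreal_mult[symmetric])
  ultimately have "J m = ennreal (1 / real m) * (\<integral>\<^sup>+x. s x \<partial>?M)"
    by (simp add: mult.assoc[symmetric])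
  then show ?thesis by (simp add: J_def R_def)
qed

section \<open>A uniform rank plus its randomizer is uniform\<close>

lemma nn_integral_unif01:
  assumes "\<phi> \<in> borel_measurable unif01"
  shows "(\<integral>\<^sup>+z. \<phi> z \<partial>unif01) = (\<integral>\<^sup>+z. \<phi> z * indicator {0..<1} z \<partial>lborel)"
proof -
  have "(\<integral>\<^sup>+z. \<phi> z \<partial>unif01) = (\<integral>\<^sup>+z. \<phi> z * indicator {0..1} z \<partial>lborel)"
    unfolding unif01_def by (subst nn_integral_restrict_space) auto
  also have "\<dots> = (\<integral>\<^sup>+z. \<phi> z * indicator {0..<1} z \<partial>lborel)"
    \<comment> \<open>The endpoint 1 is a null set; half-open intervals are the form that equal
      cells tile without overlap.\<close>
    by (intro nn_integral_cong_AE, rule AE_mp[OF AE_lborel_singleton[of "1::real"]])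
       (auto simp: indicator_def)
  finally show ?thesis .
qed

text \<open>By an affine substitution each summand is \<open>m\<close> times the integral of \<phi>
  over the cell [r/m, (r+1)/m), and the cells tile [0,1). This is what the randomizer is for: it
  spreads a discrete uniform rank evenly over its cell.\<close>

lemma nn_integral_unif01_stratify:
  assumes \<phi>: "\<phi> \<in> borel_measurable unif01" and m: "0 < m"
  shows "(\<Sum>r<m. \<integral>\<^sup>+v. \<phi> ((real r + v) / real m) \<partial>unif01) = of_nat m * (\<integral>\<^sup>+z. \<phi> z \<partial>unif01)"
proof -
  \<comment> \<open>\<phi> is measurable on [0,1] only; extended by zero it becomes a Borel function
    on the line, as the affine substitution requires.\<close>
  define \<psi> where "\<psi> z = \<phi> z * indicator {0..1} z" for z
  have [measurable]: "\<psi> \<in> borel_measurable borel"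
    using \<phi> unfolding unif01_def \<psi>_def[abs_def]
    by (subst (asm) borel_measurable_restrict_space_iff_ennreal) auto
  have "(\<integral>\<^sup>+v. \<phi> ((real r + v) / real m) \<partial>unif01)
      = of_nat m * (\<integral>\<^sup>+z. \<psi> z * indicator {real r / real m..<real (Suc r) / real m} z \<partial>lborel)"
    if r: "r < m" for r
  proof -
    have rng: "(real r + v) / real m \<in> {0..1}" if "v \<in> {0..1}" for v
      using that r by (simp add: field_simps)
    have "(\<integral>\<^sup>+v. \<phi> ((real r + v) / real m) \<partial>unif01) = (\<integral>\<^sup>+v. \<psi> ((real r + v) / real m) \<partial>unif01)"
      using rng by (intro nn_integral_cong) (simp add: \<psi>_def)
    also have "\<dots> = (\<integral>\<^sup>+v. \<psi> ((real r + v) / real m) * indicator {0..<1} v \<partial>lborel)"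
    proof (rule nn_integral_unif01)
      show "(\<lambda>v. \<psi> ((real r + v) / real m)) \<in> borel_measurable unif01"
        unfolding unif01_def by (rule measurable_restrict_space1) simp
    qed
    also have "\<dots> = (\<integral>\<^sup>+v. \<psi> (real r / real m + 1 / real m * v) *
        indicator {real r / real m..<real (Suc r) / real m} (real r / real m + 1 / real m * v) \<partial>lborel)"
      using m by (intro nn_integral_cong) (auto simp: indicator_def field_simps)
    also have "\<dots> = of_nat m * (ennreal \<bar>1 / real m\<bar> * \<dots>)"
      using m by (simp add: mult.assoc[symmetric] ennreal_of_nat_eq_real_of_nat ennreal_mult[symmetric])
    also have "ennreal \<bar>1 / real m\<bar> * (\<integral>\<^sup>+v. \<psi> (real r / real m + 1 / real m * v) *
        indicator {real r / real m..<real (Suc r) / real m} (real r / real m + 1 / real m * v) \<partial>lborel)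
      = (\<integral>\<^sup>+z. \<psi> z * indicator {real r / real m..<real (Suc r) / real m} z \<partial>lborel)"
      using m by (subst (2) nn_integral_real_affine[where t="real r / real m" and c="1 / real m"]) auto
    finally show ?thesis .
  qed
  then have "(\<Sum>r<m. \<integral>\<^sup>+v. \<phi> ((real r + v) / real m) \<partial>unif01)
      = of_nat m * (\<Sum>r<m. \<integral>\<^sup>+z. \<psi> z * indicator {real r / real m..<real (Suc r) / real m} z \<partial>lborel)"
    by (simp add: sum_distrib_left)
  also have "(\<Sum>r<m. \<integral>\<^sup>+z. \<psi> z * indicator {real r / real m..<real (Suc r) / real m} z \<partial>lborel)
      = (\<integral>\<^sup>+z. \<psi> z * (\<Sum>r<m. indicator {real r / real m..<real (Suc r) / real m} z) \<partial>lborel)"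
    by (subst nn_integral_sum[symmetric]) (auto simp: sum_distrib_left)
  also have "(\<lambda>z. \<Sum>r<m. indicator {real r / real m..<real (Suc r) / real m} z :: ennreal)
      = indicator {0..<1}"
  proof -
    have "(\<Sum>r<k. indicator {real r / real m..<real (Suc r) / real m} z :: ennreal)
        = indicator {0..<real k / real m} z" for k z
    proof (induction k)
      case (Suc k)
      have glue: "indicator {0..<a} z + indicator {a..<b} z = (indicator {0..<b} z :: ennreal)"
        if "0 \<le> a" "a \<le> b" for a b
        using that by (auto simp: indicator_def)
      show ?case unfolding sum.lessThan_Suc Suc.IH by (rule glue) (auto intro: divide_right_mono)
    qed simp
    then show ?thesis using m by auto
  qed
  also have "(\<integral>\<^sup>+z. \<psi> z * indicator {0..<1} z \<partial>lborel) = (\<integral>\<^sup>+z. \<phi> z \<partial>unif01)"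
    unfolding nn_integral_unif01[OF \<phi>] by (intro nn_integral_cong) (auto simp: \<psi>_def indicator_def)
  finally show ?thesis .
qed

text \<open>Earlier p-values never look ahead, so a new observation only adds one coordinate, and
  that coordinate depends on the past only through a rank. This is the recursion behind the
  induction below.\<close>

lemma pvals_Suc_update:
  assumes "\<And>i. i \<in> {1..n} \<Longrightarrow> x i \<noteq> y"
  shows "pvals {1..Suc n} (x(Suc n := y)) (l(Suc n := v))
    = (pvals {1..n} x l)(Suc n := (real (card {i\<in>{1..n}. x i < y}) + v) / real (Suc n))"
proof
  fix j
  have "conf_pval (x(Suc n := y), l(Suc n := v)) (Suc n)
      = (real (card {i\<in>{1..n}. (x(Suc n := y)) i < y}) + v) / real (Suc n)"
    using conf_pval_no_ties[of n "x(Suc n := y)" "l(Suc n := v)"] assms by simp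
  also have "{i\<in>{1..n}. (x(Suc n := y)) i < y} = {i\<in>{1..n}. x i < y}" by auto
  finally have last: "conf_pval (x(Suc n := y), l(Suc n := v)) (Suc n)
      = (real (card {i\<in>{1..n}. x i < y}) + v) / real (Suc n)" .
  have "conf_pval (x(Suc n := y), l(Suc n := v)) j = conf_pval (x, l) j" if "j \<in> {1..n}"
    using that by (intro conf_pval_cong) auto
  then show "pvals {1..Suc n} (x(Suc n := y)) (l(Suc n := v)) j
    = ((pvals {1..n} x l)(Suc n := (real (card {i\<in>{1..n}. x i < y}) + v) / real (Suc n))) j"
    using last by (auto simp: pvals_def)
qed

text \<open>Weighting by an arbitrary symmetric function \<open>s\<close> makes the induction go through: the rank of the
  last observation depends on the earlier ones only through their unordered set, so it can be absorbed
  into \<open>s\<close>.\<close>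

lemma nn_integral_symmetric_pvals:
  fixes s g :: "(nat \<Rightarrow> real) \<Rightarrow> ennreal"
  assumes P: "prob_space P" "sets P = sets borel" "\<And>x::real. measure P {x} = 0"
    and "s \<in> borel_measurable (PiM {1..n} (\<lambda>_. P))"
    and "\<And>x i j. i \<in> {1..n} \<Longrightarrow> j \<in> {1..n} \<Longrightarrow> s (restrict (x \<circ> Transposition.transpose i j) {1..n}) = s x"
    and "g \<in> borel_measurable (PiM {1..n} (\<lambda>_. unif01))"
  shows "(\<integral>\<^sup>+l. \<integral>\<^sup>+x. s x * g (pvals {1..n} x l) \<partial>PiM {1..n} (\<lambda>_. P) \<partial>PiM {1..n} (\<lambda>_. unif01))
    = (\<integral>\<^sup>+x. s x \<partial>PiM {1..n} (\<lambda>_. P)) * (\<integral>\<^sup>+p. g p \<partial>PiM {1..n} (\<lambda>_. unif01))"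
  using assms(4-)
proof (induction n arbitrary: s g)
  interpret P: prob_space P by fact
  interpret U: prob_space unif01 by (rule prob_space_unif01)
  interpret PP: product_sigma_finite "\<lambda>_::nat. P" ..
  interpret UU: product_sigma_finite "\<lambda>_::nat. unif01" ..
  case 0
  have "pvals {} x l = (\<lambda>_. undefined)" for x l by (simp add: pvals_def restrict_def)
  moreover have "emeasure (PiM ({} :: nat set) (\<lambda>_. unif01)) (space (PiM {} (\<lambda>_. unif01))) = 1"
    by (intro prob_space.emeasure_space_1 prob_space_PiM prob_space_unif01)
  ultimately show ?case by (simp add: PP.nn_integral_empty UU.nn_integral_empty)
next
  case (Suc n)
  interpret P: prob_space P by fact
  interpret U: prob_space unif01 by (rule prob_space_unif01)
  interpret PP: product_sigma_finite "\<lambda>_::nat. P" ..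
  interpret UU: product_sigma_finite "\<lambda>_::nat. unif01" ..
  let ?N = "Suc n"
  let ?X = "PiM {1..n} (\<lambda>_. P)" and ?V = "PiM {1..n} (\<lambda>_. unif01)"
  interpret X: prob_space ?X by (intro prob_space_PiM P)
  interpret V: prob_space ?V by (intro prob_space_PiM prob_space_unif01)
  interpret VP: pair_sigma_finite ?V P ..
  interpret UV: pair_sigma_finite unif01 ?V ..
  interpret XP: pair_sigma_finite ?X P ..
  have ins: "{1..?N} = insert ?N {1..n}" by auto
  \<comment> \<open>Fix the newest observation \<open>y\<close>, its randomizer \<open>v\<close> and
    the rank \<open>r\<close> of \<open>y\<close>. The last p-value is then the constant
    \<open>c r v\<close>, so \<open>gr r v\<close> depends on the first \<open>n\<close> p-values
    only, while \<open>sr r y\<close> is \<open>s\<close> restricted to that rank event, again a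
    symmetric function of the first \<open>n\<close> observations.\<close>
  define L where "L x y = card {i\<in>{1..n}. x i < y}" for x :: "nat \<Rightarrow> real" and y
  define c where "c r v = (real r + v) / real ?N" for r :: nat and v :: real
  define sr where "sr r y x = s (x(?N := y)) * indicator {x. L x y = r} x" for r y x
  define gr where "gr r v p = g (p(?N := c r v))" for r v p
  have c01: "c r v \<in> {0..1}" if "r \<le> n" "v \<in> {0..1}" for r v
    using that by (simp add: c_def field_simps)
  have c_meas [measurable]: "c r \<in> unif01 \<rightarrow>\<^sub>M unif01" if "r \<le> n" for r
    using c01[OF that] unfolding c_def[abs_def]
    by (intro measurable_unif01I) (auto simp: unif01_def intro!: measurable_restrict_space1)
  have updX [measurable]: "(\<lambda>\<omega>. (xx \<omega>)(?N := yy \<omega>)) \<in> M \<rightarrow>\<^sub>M PiM {1..?N} (\<lambda>_. P)"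
    if "xx \<in> M \<rightarrow>\<^sub>M ?X" "yy \<in> M \<rightarrow>\<^sub>M P" for M :: "'c measure" and xx yy
    using that by (intro measurable_fun_upd[of _ "{1..n}"]) auto
  have updV [measurable]: "(\<lambda>\<omega>. (xx \<omega>)(?N := yy \<omega>)) \<in> M \<rightarrow>\<^sub>M PiM {1..?N} (\<lambda>_. unif01)"
    if "xx \<in> M \<rightarrow>\<^sub>M ?V" "yy \<in> M \<rightarrow>\<^sub>M unif01" for M :: "'c measure" and xx yy
    using that by (intro measurable_fun_upd[of _ "{1..n}"]) auto
  have L_meas: "Measurable.pred M (\<lambda>\<omega>. L (xx \<omega>) (yy \<omega>) = r)"
    if xx: "xx \<in> M \<rightarrow>\<^sub>M ?X" and yy: "yy \<in> M \<rightarrow>\<^sub>M P" for M :: "'c measure" and xx yy r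
  proof -
    have [measurable]: "(\<lambda>\<omega>. xx \<omega> i) \<in> borel_measurable M" if "i \<in> {1..n}" for i
      using P(2) by (intro measurable_component_borel[OF xx that])
    have [measurable]: "yy \<in> borel_measurable M"
      using yy P(2) measurable_cong_sets by blast
    have *: "real (L x y) = (\<Sum>k\<in>{1..n}. if x k < y then 1 else 0)" for x y
      by (simp add: L_def sum.If_cases Int_def)
    have "(\<lambda>\<omega>. real (L (xx \<omega>) (yy \<omega>))) \<in> borel_measurable M" unfolding * by measurable
    then have "Measurable.pred M (\<lambda>\<omega>. real (L (xx \<omega>) (yy \<omega>)) = real r)" by measurable
    then show ?thesis by simp
  qed
  have sr_meas: "(\<lambda>\<omega>. sr r (yy \<omega>) (xx \<omega>)) \<in> borel_measurable M"
    if "xx \<in> M \<rightarrow>\<^sub>M ?X" "yy \<in> M \<rightarrow>\<^sub>M P" for M :: "'c measure" and xx yy r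
  proof -
    note [measurable] = L_meas[OF that] measurable_compose[OF updX[OF that] Suc.prems(1)]
    show ?thesis unfolding sr_def indicator_def of_bool_def mem_Collect_eq by measurable
  qed
  have gr_meas: "(\<lambda>\<omega>. gr r (vv \<omega>) (pp \<omega>)) \<in> borel_measurable M"
    if "pp \<in> M \<rightarrow>\<^sub>M ?V" "vv \<in> M \<rightarrow>\<^sub>M unif01" "r \<le> n" for M :: "'c measure" and pp vv r
    unfolding gr_def
    by (rule measurable_compose[OF updV Suc.prems(3)])
       (use that measurable_compose[OF that(2) c_meas[OF that(3)]] in auto)
  have pv_meas: "(\<lambda>\<omega>. pvals {1..n} (xx \<omega>) (ll \<omega>)) \<in> M \<rightarrow>\<^sub>M ?V"
    if "xx \<in> M \<rightarrow>\<^sub>M ?X" "ll \<in> M \<rightarrow>\<^sub>M ?V" for M :: "'c measure" and xx ll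
    using P by (intro measurable_pvals[OF that]) auto
  have full_meas: "(\<lambda>\<omega>. s (xx \<omega>) * g (pvals {1..?N} (xx \<omega>) (ll \<omega>))) \<in> borel_measurable M"
    if "xx \<in> M \<rightarrow>\<^sub>M PiM {1..?N} (\<lambda>_. P)" "ll \<in> M \<rightarrow>\<^sub>M PiM {1..?N} (\<lambda>_. unif01)"
    for M :: "'c measure" and xx ll
  proof -
    have "(\<lambda>\<omega>. pvals {1..?N} (xx \<omega>) (ll \<omega>)) \<in> M \<rightarrow>\<^sub>M PiM {1..?N} (\<lambda>_. unif01)"
      using P by (intro measurable_pvals[OF that]) auto
    from measurable_compose[OF this Suc.prems(3)] measurable_compose[OF that(1) Suc.prems(1)]
    show ?thesis by simp
  qed
  have term_meas: "(\<lambda>\<omega>. sr r (yy \<omega>) (xx \<omega>) * gr r (vv \<omega>) (pvals {1..n} (xx \<omega>) (ll \<omega>))) \<in> borel_measurable M"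
    if "xx \<in> M \<rightarrow>\<^sub>M ?X" "ll \<in> M \<rightarrow>\<^sub>M ?V" "yy \<in> M \<rightarrow>\<^sub>M P" "vv \<in> M \<rightarrow>\<^sub>M unif01" "r \<le> n"
    for M :: "'c measure" and xx ll yy vv r
    using that by (intro borel_measurable_times_ennreal sr_meas gr_meas pv_meas)
  have sr_sym: "sr r y (restrict (x \<circ> Transposition.transpose i j) {1..n}) = sr r y x"
    if ij: "i \<in> {1..n}" "j \<in> {1..n}" for r y x i j
  proof -
    let ?t = "Transposition.transpose i j"
    have upd: "(restrict (x \<circ> ?t) {1..n})(?N := y) = restrict ((x(?N := y)) \<circ> ?t) {1..?N}"
      using ij by (auto simp: fun_eq_iff Transposition.transpose_def)
    have 1: "s ((restrict (x \<circ> ?t) {1..n})(?N := y)) = s (x(?N := y))"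
      unfolding upd by (rule Suc.prems(2)) (use ij in auto)
    have "{k\<in>{1..n}. restrict (x \<circ> ?t) {1..n} k < y} = ?t ` {k\<in>{1..n}. x k < y}"
      using ij by (auto simp: image_iff Transposition.transpose_def split: if_splits)
    then have "L (restrict (x \<circ> ?t) {1..n}) y = L x y"
      unfolding L_def by (simp add: card_image)
    with 1 show ?thesis by (simp add: sr_def indicator_def)
  qed
  \<comment> \<open>Sum over the possible ranks of \<open>y\<close>; only the true rank contributes.
    Ties between \<open>y\<close> and the earlier sample are null because \<open>P\<close> has no
    atoms.\<close>
  have split: "(\<integral>\<^sup>+x. s (x(?N := y)) * g (pvals {1..?N} (x(?N := y)) (l(?N := v))) \<partial>?X)
      = (\<Sum>r\<le>n. \<integral>\<^sup>+x. sr r y x * gr r v (pvals {1..n} x l) \<partial>?X)"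
    if l: "l \<in> space ?V" and v: "v \<in> space unif01" and y: "y \<in> space P" for l v y
  proof -
    have AE1: "AE x in ?X. x i \<noteq> y" if "i \<in> {1..n}" for i
    proof (rule AE_PiM_component[where P="\<lambda>z. z \<noteq> y"])
      show "AE z in P. z \<noteq> y"
        using P by (intro AE_I[where N="{y}"]) (auto simp: P.emeasure_eq_measure)
    qed (use P that in auto)
    then have AE2: "AE x in ?X. \<forall>i\<in>{1..n}. x i \<noteq> y"
      by (subst AE_finite_all) auto
    have "(\<integral>\<^sup>+x. s (x(?N := y)) * g (pvals {1..?N} (x(?N := y)) (l(?N := v))) \<partial>?X)
      = (\<integral>\<^sup>+x. (\<Sum>r\<le>n. sr r y x * gr r v (pvals {1..n} x l)) \<partial>?X)"
    proof (rule nn_integral_cong_AE, use AE2 in eventually_elim)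
      case (elim x)
      have "L x y \<le> card {1..n}" unfolding L_def by (rule card_mono) auto
      then have "L x y \<le> n" by simp
      have "(\<Sum>r\<le>n. sr r y x * gr r v (pvals {1..n} x l))
          = (\<Sum>r\<le>n. if r = L x y then s (x(?N := y)) * gr r v (pvals {1..n} x l) else 0)"
        by (intro sum.cong) (auto simp: sr_def)
      also have "\<dots> = s (x(?N := y)) * gr (L x y) v (pvals {1..n} x l)"
        using \<open>L x y \<le> n\<close> by simp
      also have "gr (L x y) v (pvals {1..n} x l) = g (pvals {1..?N} (x(?N := y)) (l(?N := v)))"
        using elim by (subst pvals_Suc_update) (auto simp: gr_def c_def L_def)
      finally show ?case by (rule sym)
    qed
    also have "\<dots> = (\<Sum>r\<le>n. \<integral>\<^sup>+x. sr r y x * gr r v (pvals {1..n} x l) \<partial>?X)"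
      using l v y by (intro nn_integral_sum term_meas) auto
    finally show ?thesis .
  qed
  have inner_meas: "(\<lambda>\<omega>. \<integral>\<^sup>+x. sr r (yy \<omega>) x * gr r (vv \<omega>) (pvals {1..n} x (ll \<omega>)) \<partial>?X) \<in> borel_measurable M"
    if "ll \<in> M \<rightarrow>\<^sub>M ?V" "yy \<in> M \<rightarrow>\<^sub>M P" "vv \<in> M \<rightarrow>\<^sub>M unif01" "r \<le> n" for M :: "'c measure" and ll yy vv r
    by (rule X.borel_measurable_nn_integral, unfold case_prod_beta, rule term_meas)
       (use that in \<open>auto intro: measurable_compose[OF measurable_fst]\<close>)
  have inner_meas_l: "(\<lambda>\<omega>. \<integral>\<^sup>+y. \<integral>\<^sup>+x. sr r y x * gr r (vv \<omega>) (pvals {1..n} x (ll \<omega>)) \<partial>?X \<partial>P) \<in> borel_measurable M"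
    if "ll \<in> M \<rightarrow>\<^sub>M ?V" "vv \<in> M \<rightarrow>\<^sub>M unif01" "r \<le> n" for M :: "'c measure" and ll vv r
    by (rule P.borel_measurable_nn_integral, unfold case_prod_beta, rule inner_meas)
       (use that in \<open>auto intro: measurable_compose[OF measurable_fst]\<close>)
  define \<psi> where "\<psi> z = (\<integral>\<^sup>+p. g (p(?N := z)) \<partial>?V)" for z
  have \<psi>_meas: "\<psi> \<in> borel_measurable unif01"
    unfolding \<psi>_def[abs_def]
    by (rule V.borel_measurable_nn_integral, unfold case_prod_beta)
       (rule measurable_compose[OF updV Suc.prems(3)], auto)
  \<comment> \<open>Integrating \<open>y\<close> back in recovers the full sample, and there the
    rank event carries the share 1/(n+1) of the integral of \<open>s\<close>, whatever
    \<open>r\<close> is.\<close>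
  have rank: "(\<integral>\<^sup>+y. \<integral>\<^sup>+x. sr r y x \<partial>?X \<partial>P)
      = ennreal (1 / real ?N) * (\<integral>\<^sup>+x. s x \<partial>PiM {1..?N} (\<lambda>_. P))" if "r \<le> n" for r
  proof -
    have eq: "{k\<in>{1..?N}. (x(?N := y)) k < (x(?N := y)) ?N} = {k\<in>{1..n}. x k < y}"
      for x :: "nat \<Rightarrow> real" and y by auto
    have sx: "s (x(?N := y)) * indicator {x. card {k\<in>{1..?N}. x k < x ?N} = r} (x(?N := y)) = sr r y x" for x y
      unfolding sr_def L_def indicator_def mem_Collect_eq eq ..
    have m: "(\<lambda>x. s x * indicator {x. card {k\<in>{1..?N}. x k < x ?N} = r} x) \<in> borel_measurable (PiM {1..?N} (\<lambda>_. P))"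
    proof -
      have "(\<lambda>x. sr r (x ?N) (restrict x {1..n})) \<in> borel_measurable (PiM {1..?N} (\<lambda>_. P))"
        by (intro sr_meas measurable_restrict_subset) auto
      also have "?this \<longleftrightarrow> ?thesis"
      proof (rule measurable_cong)
        fix x assume "x \<in> space (PiM {1..?N} (\<lambda>_. P))"
        then have "(restrict x {1..n})(?N := x ?N) = x"
          by (auto simp: fun_eq_iff space_PiM PiE_iff extensional_def)
        with sx[of "restrict x {1..n}" "x ?N"]
        show "sr r (x ?N) (restrict x {1..n}) = s x * indicator {x. card {k\<in>{1..?N}. x k < x ?N} = r} x"
          by simp
      qed
      finally show ?thesis .
    qed
    have "ennreal (1 / real ?N) * (\<integral>\<^sup>+x. s x \<partial>PiM {1..?N} (\<lambda>_. P))
        = (\<integral>\<^sup>+x. s x * indicator {x. card {k\<in>{1..?N}. x k < x ?N} = r} x \<partial>PiM {1..?N} (\<lambda>_. P))"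
      using nn_integral_rank[OF P Suc.prems(1,2), of r] that by simp
    also have "\<dots> = (\<integral>\<^sup>+y. \<integral>\<^sup>+x. s (x(?N := y)) * indicator {x. card {k\<in>{1..?N}. x k < x ?N} = r} (x(?N := y)) \<partial>?X \<partial>P)"
      using m unfolding ins by (subst PP.product_nn_integral_insert_rev) auto
    finally show ?thesis unfolding sx by simp
  qed
  \<comment> \<open>The last coordinates are made the outer integrals, so that \<open>v\<close> and
    \<open>y\<close> are held fixed while the induction hypothesis is applied to the first
    \<open>n\<close> coordinates.\<close>
  have "(\<integral>\<^sup>+l. \<integral>\<^sup>+x. s x * g (pvals {1..?N} x l) \<partial>PiM {1..?N} (\<lambda>_. P) \<partial>PiM {1..?N} (\<lambda>_. unif01))
    = (\<integral>\<^sup>+v. \<integral>\<^sup>+l. (\<integral>\<^sup>+x. s x * g (pvals {1..?N} x (l(?N := v))) \<partial>PiM {1..?N} (\<lambda>_. P)) \<partial>?V \<partial>unif01)"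
  proof -
    interpret XN: prob_space "PiM {1..?N} (\<lambda>_. P)" by (intro prob_space_PiM P)
    have "(\<lambda>l. \<integral>\<^sup>+x. s x * g (pvals {1..?N} x l) \<partial>PiM {1..?N} (\<lambda>_. P)) \<in> borel_measurable (PiM {1..?N} (\<lambda>_. unif01))"
      by (rule XN.borel_measurable_nn_integral, unfold case_prod_beta, rule full_meas) auto
    then show ?thesis
      using UU.product_nn_integral_insert_rev[of "{1..n}" ?N, folded ins] by simp
  qed
  also have "\<dots> = (\<integral>\<^sup>+v. \<integral>\<^sup>+l. (\<integral>\<^sup>+y. \<integral>\<^sup>+x. s (x(?N := y)) * g (pvals {1..?N} (x(?N := y)) (l(?N := v))) \<partial>?X \<partial>P) \<partial>?V \<partial>unif01)"
  proof (intro nn_integral_cong)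
    fix v l assume "v \<in> space unif01" "l \<in> space ?V"
    then have "l(?N := v) \<in> space (PiM {1..?N} (\<lambda>_. unif01))"
      using measurable_space[OF updV[of "\<lambda>_. l" unif01 "\<lambda>v. v"]] by simp
    then have "(\<lambda>x. s x * g (pvals {1..?N} x (l(?N := v)))) \<in> borel_measurable (PiM {1..?N} (\<lambda>_. P))"
      by (intro full_meas) auto
    then show "(\<integral>\<^sup>+x. s x * g (pvals {1..?N} x (l(?N := v))) \<partial>PiM {1..?N} (\<lambda>_. P))
      = (\<integral>\<^sup>+y. \<integral>\<^sup>+x. s (x(?N := y)) * g (pvals {1..?N} (x(?N := y)) (l(?N := v))) \<partial>?X \<partial>P)"
      using PP.product_nn_integral_insert_rev[of "{1..n}" ?N, folded ins] by simp
  qed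
  also have "\<dots> = (\<integral>\<^sup>+v. \<integral>\<^sup>+l. (\<integral>\<^sup>+y. (\<Sum>r\<le>n. \<integral>\<^sup>+x. sr r y x * gr r v (pvals {1..n} x l) \<partial>?X) \<partial>P) \<partial>?V \<partial>unif01)"
    by (intro nn_integral_cong split)
  also have "\<dots> = (\<integral>\<^sup>+v. \<integral>\<^sup>+l. (\<Sum>r\<le>n. \<integral>\<^sup>+y. \<integral>\<^sup>+x. sr r y x * gr r v (pvals {1..n} x l) \<partial>?X \<partial>P) \<partial>?V \<partial>unif01)"
    by (intro nn_integral_cong nn_integral_sum inner_meas) auto
  also have "\<dots> = (\<integral>\<^sup>+v. (\<Sum>r\<le>n. \<integral>\<^sup>+l. \<integral>\<^sup>+y. \<integral>\<^sup>+x. sr r y x * gr r v (pvals {1..n} x l) \<partial>?X \<partial>P \<partial>?V) \<partial>unif01)"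
    by (intro nn_integral_cong nn_integral_sum inner_meas_l) auto
  also have "\<dots> = (\<integral>\<^sup>+v. (\<Sum>r\<le>n. (\<integral>\<^sup>+y. \<integral>\<^sup>+x. sr r y x \<partial>?X \<partial>P) * \<psi> (c r v)) \<partial>unif01)"
  proof (intro nn_integral_cong sum.cong refl)
    fix v r assume v: "v \<in> space unif01" and "r \<in> {..n}"
    then have r: "r \<le> n" by simp
    have "(\<integral>\<^sup>+l. \<integral>\<^sup>+y. \<integral>\<^sup>+x. sr r y x * gr r v (pvals {1..n} x l) \<partial>?X \<partial>P \<partial>?V)
        = (\<integral>\<^sup>+y. \<integral>\<^sup>+l. \<integral>\<^sup>+x. sr r y x * gr r v (pvals {1..n} x l) \<partial>?X \<partial>?V \<partial>P)"
      by (rule VP.Fubini'[symmetric], unfold case_prod_beta, rule inner_meas) (use v r in auto)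
    also have "\<dots> = (\<integral>\<^sup>+y. (\<integral>\<^sup>+x. sr r y x \<partial>?X) * \<psi> (c r v) \<partial>P)"
    \<comment> \<open>Here the induction hypothesis enters, with \<open>sr r y\<close> and
      \<open>gr r v\<close> in the roles of \<open>s\<close> and \<open>g\<close>.\<close>
    proof (rule nn_integral_cong)
      fix y assume "y \<in> space P"
      then have "(\<integral>\<^sup>+l. \<integral>\<^sup>+x. sr r y x * gr r v (pvals {1..n} x l) \<partial>?X \<partial>?V)
        = (\<integral>\<^sup>+x. sr r y x \<partial>?X) * (\<integral>\<^sup>+p. gr r v p \<partial>?V)"
        using v r by (intro Suc.IH sr_meas gr_meas sr_sym) auto
      then show "(\<integral>\<^sup>+l. \<integral>\<^sup>+x. sr r y x * gr r v (pvals {1..n} x l) \<partial>?X \<partial>?V)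
        = (\<integral>\<^sup>+x. sr r y x \<partial>?X) * \<psi> (c r v)"
        by (simp add: gr_def \<psi>_def)
    qed
    also have "\<dots> = (\<integral>\<^sup>+y. \<integral>\<^sup>+x. sr r y x \<partial>?X \<partial>P) * \<psi> (c r v)"
      by (rule nn_integral_multc, rule X.borel_measurable_nn_integral, unfold case_prod_beta, rule sr_meas) auto
    finally show "(\<integral>\<^sup>+l. \<integral>\<^sup>+y. \<integral>\<^sup>+x. sr r y x * gr r v (pvals {1..n} x l) \<partial>?X \<partial>P \<partial>?V)
        = (\<integral>\<^sup>+y. \<integral>\<^sup>+x. sr r y x \<partial>?X \<partial>P) * \<psi> (c r v)" .
  qed
  also have "\<dots> = (\<integral>\<^sup>+v. (\<Sum>r\<le>n. ennreal (1 / real ?N) * (\<integral>\<^sup>+x. s x \<partial>PiM {1..?N} (\<lambda>_. P)) * \<psi> (c r v)) \<partial>unif01)"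
    by (intro nn_integral_cong sum.cong refl arg_cong2[where f="(*)"] rank) simp
  also have "\<dots> = ennreal (1 / real ?N) * (\<integral>\<^sup>+x. s x \<partial>PiM {1..?N} (\<lambda>_. P))
      * (\<Sum>r\<le>n. \<integral>\<^sup>+v. \<psi> (c r v) \<partial>unif01)"
    using measurable_compose[OF c_meas \<psi>_meas]
    by (subst nn_integral_sum) (auto simp: nn_integral_cmult sum_distrib_left)
  \<comment> \<open>All ranks have the same share, so what is left is a stratified average of
    \<psi>, that is, the integral over a uniform last p-value. The factors 1/N and N cancel.\<close>
  also have "(\<Sum>r\<le>n. \<integral>\<^sup>+v. \<psi> (c r v) \<partial>unif01) = of_nat ?N * (\<integral>\<^sup>+z. \<psi> z \<partial>unif01)"
    using nn_integral_unif01_stratify[OF \<psi>_meas, of ?N] by (simp add: c_def lessThan_Suc_atMost)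
  also have "(\<integral>\<^sup>+z. \<psi> z \<partial>unif01) = (\<integral>\<^sup>+p. g p \<partial>PiM {1..?N} (\<lambda>_. unif01))"
    using UU.product_nn_integral_insert_rev[of "{1..n}" ?N g, folded ins] Suc.prems(3) by (simp add: \<psi>_def)
  also have "ennreal (1 / real ?N) * (\<integral>\<^sup>+x. s x \<partial>PiM {1..?N} (\<lambda>_. P)) * (of_nat ?N * (\<integral>\<^sup>+p. g p \<partial>PiM {1..?N} (\<lambda>_. unif01)))
     = (ennreal (1 / real ?N) * of_nat ?N) * ((\<integral>\<^sup>+x. s x \<partial>PiM {1..?N} (\<lambda>_. P)) * (\<integral>\<^sup>+p. g p \<partial>PiM {1..?N} (\<lambda>_. unif01)))"
    by (simp only: ac_simps)
  also have "ennreal (1 / real ?N) * of_nat ?N = 1"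
    unfolding ennreal_of_nat_eq_real_of_nat by (subst ennreal_mult[symmetric]) auto
  finally show ?case by simp
qed

subsection \<open>False alarms in a row of the array\<close>

definition obs_law :: "real measure \<Rightarrow> nat \<Rightarrow> real measure \<Rightarrow> nat \<Rightarrow> real measure" where
  "obs_law P0 T P1 j = (if j \<le> T then P0 else P1)"

lemma row_law_eq: "row_law P0 T P1 = PiM {1..} (obs_law P0 T P1) \<Otimes>\<^sub>M PiM {1..} (\<lambda>_. unif01)"
  by (simp add: row_law_def obs_law_def[abs_def])

lemma prob_space_obs_law: "prob_space P0 \<Longrightarrow> prob_space P1 \<Longrightarrow> prob_space (obs_law P0 T P1 j)"
  by (simp add: obs_law_def)

lemma sets_obs_law: "sets P0 = sets borel \<Longrightarrow> sets P1 = sets borel \<Longrightarrow> sets (obs_law P0 T P1 j) = sets borel"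
  by (simp add: obs_law_def)

lemma prob_space_row_law:
  assumes "prob_space P0" "prob_space P1"
  shows "prob_space (row_law P0 T P1)"
proof -
  interpret X: prob_space "PiM {1..} (obs_law P0 T P1)"
    using assms by (intro prob_space_PiM prob_space_obs_law)
  interpret V: prob_space "PiM {1..} (\<lambda>_::nat. unif01)"
    by (intro prob_space_PiM prob_space_unif01)
  interpret XV: pair_prob_space "PiM {1..} (obs_law P0 T P1)" "PiM {1..} (\<lambda>_::nat. unif01)" ..
  show ?thesis unfolding row_law_eq by unfold_locales
qed

text \<open>The randomizers are the outer variables: with them fixed, p-values are functions of the
  observations alone. Both the uniformity identity and the drift estimate have this shape.\<close>

lemma nn_integral_row_law:
  assumes "prob_space P0" "prob_space P1" "g \<in> borel_measurable (row_law P0 T P1)"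
  shows "(\<integral>\<^sup>+\<omega>. g \<omega> \<partial>row_law P0 T P1)
    = (\<integral>\<^sup>+l. \<integral>\<^sup>+x. g (x, l) \<partial>PiM {1..} (obs_law P0 T P1) \<partial>PiM {1..} (\<lambda>_. unif01))"
proof -
  interpret X: prob_space "PiM {1..} (obs_law P0 T P1)"
    using assms by (intro prob_space_PiM prob_space_obs_law)
  interpret V: prob_space "PiM {1..} (\<lambda>_::nat. unif01)"
    by (intro prob_space_PiM prob_space_unif01)
  interpret XV: pair_sigma_finite "PiM {1..} (obs_law P0 T P1)" "PiM {1..} (\<lambda>_::nat. unif01)" ..
  show ?thesis using assms(3) unfolding row_law_eq by (rule XV.nn_integral_snd[symmetric])
qed

text \<open>Finite-dimensional marginals of an infinite product, in the form that discards every
  coordinate on which the integrand does not depend.\<close>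

lemma nn_integral_PiM_restrict:
  assumes "\<And>i. prob_space (M i)" "finite J" "J \<subseteq> I" "g \<in> borel_measurable (PiM J M)"
  shows "(\<integral>\<^sup>+x. g (restrict x J) \<partial>PiM I M) = (\<integral>\<^sup>+x. g x \<partial>PiM J M)"
proof -
  interpret product_prob_space M I
    using assms(1) by (intro product_prob_spaceI)
  have "(\<integral>\<^sup>+x. g x \<partial>PiM J M) = (\<integral>\<^sup>+x. g x \<partial>distr (PiM I M) (PiM J M) (\<lambda>x. restrict x J))"
    using assms by (simp add: distr_PiM_restrict_finite)
  also have "\<dots> = (\<integral>\<^sup>+x. g (restrict x J) \<partial>PiM I M)"
    using assms by (intro nn_integral_distr measurable_restrict_subset) auto
  finally show ?thesis by simp
qed

lemma measurable_pvals_row_law: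
  assumes "sets P0 = sets borel" "sets P1 = sets borel"
  shows "(\<lambda>\<omega>. pvals {1..} (fst \<omega>) (snd \<omega>)) \<in> row_law P0 T P1 \<rightarrow>\<^sub>M PiM {1..} (\<lambda>_. unif01)"
  unfolding row_law_eq
  using sets_obs_law[OF assms] by (intro measurable_pvals[OF measurable_fst measurable_snd]) auto

lemma measurable_conf_pval_row_law:
  assumes "sets P0 = sets borel" "sets P1 = sets borel" "1 \<le> j"
  shows "(\<lambda>\<omega>. conf_pval \<omega> j) \<in> row_law P0 T P1 \<rightarrow>\<^sub>M unif01"
proof -
  have "(\<lambda>\<omega>. pvals {1..} (fst \<omega>) (snd \<omega>) j) \<in> row_law P0 T P1 \<rightarrow>\<^sub>M unif01"
    using measurable_compose[OF measurable_pvals_row_law measurable_component_singleton] assms by simp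
  then show ?thesis using assms(3) by (simp add: pvals_def)
qed

lemma borel_measurable_Z_row_law:
  assumes "sets P0 = sets borel" "sets P1 = sets borel" "prob_space Q" "density_family Q f"
  shows "(\<lambda>\<omega>. Z_stat Q f w (conf_pval \<omega>) t) \<in> borel_measurable (row_law P0 T P1)"
proof -
  have "Z_stat Q f w (conf_pval \<omega>) t = Z_stat Q f w (pvals {1..} (fst \<omega>) (snd \<omega>)) t" for \<omega>
    unfolding Z_stat_def
    by (intro arg_cong[where f=Max] image_cong refl arg_cong2[where f="(*)"] mix_lik_cong)
       (auto simp: pvals_def)
  then show ?thesis
    using measurable_compose[OF measurable_pvals_row_law[OF assms(1,2)]
      borel_measurable_Z_stat[OF assms(3,4), of t "{1..}" w]] by simp
qed

lemma borel_measurable_S_row_law: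
  assumes "sets P0 = sets borel" "sets P1 = sets borel" "prob_space Q" "density_family Q f"
  shows "(\<lambda>\<omega>. S_stat Q f w (conf_pval \<omega>) t) \<in> borel_measurable (row_law P0 T P1)"
proof -
  have "S_stat Q f w (conf_pval \<omega>) t = S_stat Q f w (pvals {1..} (fst \<omega>) (snd \<omega>)) t" for \<omega>
    by (intro S_stat_cong) (auto simp: pvals_def)
  then show ?thesis
    using measurable_compose[OF measurable_pvals_row_law[OF assms(1,2)]
      borel_measurable_S_stat[OF assms(3,4), of t "{1..}" w]] by simp
qed

text \<open>An alarm by time \<open>T\<close> is decided by the first \<open>T\<close> observations
  and randomizers. These observations all come from \<open>P0\<close>, so the infinite row reduces
  to an i.i.d. sample and then to uniform p-values. The bound is stated for the larger of the two
  statistics and holds at each fixed \<open>T\<close>.\<close>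

lemma false_alarm_row_law:
  assumes P0: "prob_space P0" "sets P0 = sets borel" "\<And>x. measure P0 {x} = 0"
    and P1: "prob_space P1" "sets P1 = sets borel"
    and Q: "prob_space Q" "density_family Q f"
    and w: "\<And>k. 1 \<le> k \<Longrightarrow> 0 \<le> w k" "(\<Sum>k=1..T. w k) \<le> 1" and \<alpha>: "0 < \<alpha>"
  shows "emeasure (row_law P0 T P1) {\<omega> \<in> space (row_law P0 T P1).
           \<exists>t\<in>{1..T}. ennreal (1 / \<alpha>) \<le> S_stat Q f w (conf_pval \<omega>) t} \<le> ennreal \<alpha>"
proof -
  let ?J = "{1..T}" and ?M = "obs_law P0 T P1"
  let ?V = "PiM ?J (\<lambda>_. unif01)" and ?R = "row_law P0 T P1"
  define A where "A = {p \<in> space ?V. \<exists>t\<in>?J. ennreal (1 / \<alpha>) \<le> S_stat Q f w p t}"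
  define B where "B = {\<omega> \<in> space ?R. \<exists>t\<in>?J. ennreal (1 / \<alpha>) \<le> S_stat Q f w (conf_pval \<omega>) t}"
  have M: "prob_space (?M i)" "sets (?M i) = sets borel" for i
    using P0 P1 by (simp_all add: prob_space_obs_law sets_obs_law)
  interpret U: prob_space unif01 by (rule prob_space_unif01)
  interpret XJ: prob_space "PiM ?J ?M" by (intro prob_space_PiM M)
  have A_sets: "A \<in> sets ?V"
  proof -
    have [measurable]: "(\<lambda>p. S_stat Q f w p t) \<in> borel_measurable ?V" if "t \<in> ?J" for t
      using that by (intro borel_measurable_S_stat Q) auto
    show ?thesis unfolding A_def by measurable
  qed
  have B_sets: "B \<in> sets ?R"
  proof -
    have [measurable]: "(\<lambda>\<omega>. S_stat Q f w (conf_pval \<omega>) t) \<in> borel_measurable ?R" for t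
      by (intro borel_measurable_S_row_law P0 P1 Q)
    show ?thesis unfolding B_def by measurable
  qed
  have pv_meas: "(\<lambda>\<omega>. pvals ?J (xx \<omega>) (ll \<omega>)) \<in> N \<rightarrow>\<^sub>M ?V"
    if "xx \<in> N \<rightarrow>\<^sub>M PiM ?J ?M" "ll \<in> N \<rightarrow>\<^sub>M ?V" for N :: "'c measure" and xx ll
    by (intro measurable_pvals[OF that]) (auto simp: M)
  have B_eq: "indicator B (x, l) = (indicator A (pvals ?J (restrict x ?J) (restrict l ?J)) :: ennreal)"
    if x: "x \<in> space (PiM {1..} ?M)" and l: "l \<in> space (PiM {1..} (\<lambda>_. unif01))" for x l
  proof -
    have rJ: "restrict x ?J \<in> space (PiM ?J ?M)" "restrict l ?J \<in> space ?V"
      using x l by (auto simp: space_PiM)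
    have "pvals ?J (restrict x ?J) (restrict l ?J) \<in> space ?V"
      using measurable_space[OF pv_meas[of "\<lambda>x. x" "PiM ?J ?M" "\<lambda>_. restrict l ?J"]] rJ by auto
    moreover have "S_stat Q f w (pvals ?J (restrict x ?J) (restrict l ?J)) t = S_stat Q f w (conf_pval (x, l)) t"
      if "t \<in> ?J" for t
      using that by (intro S_stat_cong) (auto simp: pvals_def intro!: conf_pval_cong)
    moreover have "(x, l) \<in> space ?R" using x l by (simp add: row_law_eq space_pair_measure)
    ultimately show ?thesis by (auto simp: A_def B_def indicator_def)
  qed
  have "emeasure ?R B = (\<integral>\<^sup>+\<omega>. indicator B \<omega> \<partial>?R)" using B_sets by simp
  also have "\<dots> = (\<integral>\<^sup>+l. \<integral>\<^sup>+x. indicator B (x, l) \<partial>PiM {1..} ?M \<partial>PiM {1..} (\<lambda>_. unif01))"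
    using B_sets by (intro nn_integral_row_law P0 P1) auto
  also have "\<dots> = (\<integral>\<^sup>+l. \<integral>\<^sup>+x. indicator A (pvals ?J (restrict x ?J) (restrict l ?J))
      \<partial>PiM {1..} ?M \<partial>PiM {1..} (\<lambda>_. unif01))"
    by (intro nn_integral_cong B_eq)
  also have "\<dots> = (\<integral>\<^sup>+l. \<integral>\<^sup>+x. indicator A (pvals ?J x (restrict l ?J)) \<partial>PiM ?J ?M \<partial>PiM {1..} (\<lambda>_. unif01))"
  proof (intro nn_integral_cong)
    fix l :: "nat \<Rightarrow> real" assume "l \<in> space (PiM {1..} (\<lambda>_. unif01))"
    then have "restrict l ?J \<in> space ?V" by (auto simp: space_PiM)
    then have "(\<lambda>x. pvals ?J x (restrict l ?J)) \<in> PiM ?J ?M \<rightarrow>\<^sub>M ?V" by (intro pv_meas) auto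
    from measurable_compose[OF this borel_measurable_indicator[OF A_sets]]
    show "(\<integral>\<^sup>+x. indicator A (pvals ?J (restrict x ?J) (restrict l ?J)) \<partial>PiM {1..} ?M)
      = (\<integral>\<^sup>+x. indicator A (pvals ?J x (restrict l ?J)) \<partial>PiM ?J ?M)"
      by (intro nn_integral_PiM_restrict M) auto
  qed
  also have "\<dots> = (\<integral>\<^sup>+l. \<integral>\<^sup>+x. indicator A (pvals ?J x l) \<partial>PiM ?J ?M \<partial>?V)"
  proof (rule nn_integral_PiM_restrict)
    have "(\<lambda>\<omega>. indicator A (pvals ?J (snd \<omega>) (fst \<omega>)) :: ennreal) \<in> borel_measurable (?V \<Otimes>\<^sub>M PiM ?J ?M)"
      by (intro measurable_compose[OF _ borel_measurable_indicator[OF A_sets]] pv_meas measurable_fst measurable_snd)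
    then show "(\<lambda>l. \<integral>\<^sup>+x. indicator A (pvals ?J x l) \<partial>PiM ?J ?M) \<in> borel_measurable ?V"
      by (intro XJ.borel_measurable_nn_integral) (simp add: case_prod_beta)
  qed (auto intro: prob_space_unif01)
  also have "PiM ?J ?M = PiM ?J (\<lambda>_. P0)" by (intro PiM_cong) (auto simp: obs_law_def)
  \<comment> \<open>With the trivial weight \<open>s = 1\<close> the identity says that the vector
    of p-values has the uniform product as its law.\<close>
  also have "(\<integral>\<^sup>+l. \<integral>\<^sup>+x. indicator A (pvals ?J x l) \<partial>PiM ?J (\<lambda>_. P0) \<partial>?V)
      = (\<integral>\<^sup>+x. 1 \<partial>PiM ?J (\<lambda>_. P0)) * (\<integral>\<^sup>+p. indicator A p \<partial>?V)"
    using nn_integral_symmetric_pvals[OF P0, of "\<lambda>_. 1" T "indicator A"] A_sets by simp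
  also have "(\<integral>\<^sup>+x. 1 \<partial>PiM ?J (\<lambda>_. P0)) = 1"
    using prob_space.emeasure_space_1[OF prob_space_PiM[of ?J "\<lambda>_. P0"]] P0 by simp
  also have "(\<integral>\<^sup>+p. indicator A p \<partial>?V) = emeasure ?V A" using A_sets by simp
  also have "emeasure ?V A \<le> ennreal \<alpha>"
    unfolding A_def by (rule false_alarm_uniform[OF Q w \<alpha>])
  finally show ?thesis by (simp add: B_def)
qed

section \<open>Moments of sums of independent centred bounded variables\<close>

lemma nn_integral_sum_square_le:
  fixes g :: "'i \<Rightarrow> 'a \<Rightarrow> real"
  assumes M: "\<And>i. prob_space (M i)" and "finite I"
    and g: "\<And>i. i \<in> I \<Longrightarrow> g i \<in> borel_measurable (M i)"
    and bound: "\<And>i y. i \<in> I \<Longrightarrow> y \<in> space (M i) \<Longrightarrow> \<bar>g i y\<bar> \<le> B"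
    and mean: "\<And>i. i \<in> I \<Longrightarrow> (\<integral>y. g i y \<partial>M i) = 0"
  shows "(\<integral>\<^sup>+x. ennreal ((\<Sum>i\<in>I. g i (x i))\<^sup>2) \<partial>PiM I M) \<le> ennreal (real (card I) * B\<^sup>2)"
  using assms(2-)
proof (induction I)
  case empty
  then show ?case by simp
next
  case (insert j I)
  interpret M: prob_space "M i" for i by (rule M)
  interpret PM: product_sigma_finite M ..
  interpret MI: prob_space "PiM I M" by (intro prob_space_PiM M)
  \<comment> \<open>Integrating out one coordinate: the cross term vanishes because
    \<open>g j\<close> has mean 0, so the second moment grows by at most
    \<open>B\<^sup>2\<close>.\<close>
  have step: "(\<integral>\<^sup>+y. ennreal ((c + g j y)\<^sup>2) \<partial>M j) \<le> ennreal (c\<^sup>2 + B\<^sup>2)" for c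
  proof -
    have int: "integrable (M j) (g j)"
      using insert.prems by (intro M.integrable_const_bound[where B=B]) auto
    have gB: "(g j y)\<^sup>2 \<le> B\<^sup>2" if "y \<in> space (M j)" for y
      using insert.prems(2)[of j y] that by (simp add: abs_le_square_iff[symmetric])
    have [measurable]: "g j \<in> borel_measurable (M j)" using insert.prems by simp
    have int2: "integrable (M j) (\<lambda>y. (g j y)\<^sup>2)"
      using gB by (intro M.integrable_const_bound[where B="B\<^sup>2"]) auto
    have expand: "(c + g j y)\<^sup>2 = c\<^sup>2 + 2 * c * g j y + (g j y)\<^sup>2" for y
      by (simp add: power2_eq_square algebra_simps)
    have "integrable (M j) (\<lambda>y. (c + g j y)\<^sup>2)" unfolding expand using int int2 by auto
    then have "(\<integral>\<^sup>+y. ennreal ((c + g j y)\<^sup>2) \<partial>M j) = ennreal (\<integral>y. (c + g j y)\<^sup>2 \<partial>M j)"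
      by (intro nn_integral_eq_integral) auto
    also have "(\<integral>y. (c + g j y)\<^sup>2 \<partial>M j) = c\<^sup>2 + (\<integral>y. (g j y)\<^sup>2 \<partial>M j)"
      unfolding expand using int int2 insert.prems(3)[of j] by (simp add: M.prob_space)
    also have "(\<integral>y. (g j y)\<^sup>2 \<partial>M j) \<le> (\<integral>y. B\<^sup>2 \<partial>M j)"
      using int2 gB by (intro integral_mono) auto
    finally show ?thesis by (simp add: M.prob_space ennreal_leI)
  qed
  have gi [measurable]: "(\<lambda>x. g i (x i)) \<in> borel_measurable (PiM K M)" if "i \<in> insert j I" "i \<in> K" for i K
    using insert.prems(1)[OF that(1)] that(2) by measurable
  have "(\<integral>\<^sup>+x. ennreal ((\<Sum>i\<in>insert j I. g i (x i))\<^sup>2) \<partial>PiM (insert j I) M)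
      = (\<integral>\<^sup>+x. \<integral>\<^sup>+y. ennreal ((\<Sum>i\<in>insert j I. g i ((x(j := y)) i))\<^sup>2) \<partial>M j \<partial>PiM I M)"
    using insert.hyps by (intro PM.product_nn_integral_insert) auto
  also have "\<dots> = (\<integral>\<^sup>+x. \<integral>\<^sup>+y. ennreal (((\<Sum>i\<in>I. g i (x i)) + g j y)\<^sup>2) \<partial>M j \<partial>PiM I M)"
  proof -
    have "(\<Sum>i\<in>insert j I. g i ((x(j := y)) i)) = (\<Sum>i\<in>I. g i (x i)) + g j y" for x y
    proof -
      have "(\<Sum>i\<in>I. g i ((x(j := y)) i)) = (\<Sum>i\<in>I. g i (x i))"
        using insert.hyps by (intro sum.cong) auto
      then show ?thesis using insert.hyps by simp
    qed
    then show ?thesis by simp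
  qed
  also have "\<dots> \<le> (\<integral>\<^sup>+x. ennreal ((\<Sum>i\<in>I. g i (x i))\<^sup>2) + ennreal (B\<^sup>2) \<partial>PiM I M)"
    by (intro nn_integral_mono order_trans[OF step]) (simp add: ennreal_plus[symmetric] del: ennreal_plus)
  also have "\<dots> = (\<integral>\<^sup>+x. ennreal ((\<Sum>i\<in>I. g i (x i))\<^sup>2) \<partial>PiM I M) + ennreal (B\<^sup>2)"
    by (subst nn_integral_add) (auto simp: MI.emeasure_space_1)
  also have "\<dots> \<le> ennreal (real (card I) * B\<^sup>2) + ennreal (B\<^sup>2)"
    using insert by (intro add_right_mono) auto
  also have "\<dots> = ennreal (real (card (insert j I)) * B\<^sup>2)"
    using insert.hyps by (simp add: ennreal_plus[symmetric] algebra_simps del: ennreal_plus)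
  finally show ?case .
qed

text \<open>The second moment bound becomes a first moment bound through
  \<open>\<bar>u\<bar> \<le> s + u\<^sup>2 / s\<close>, with \<open>s\<close> the square root of the
  number of terms, which makes both summands of order \<open>s\<close>. This elementary substitute
  for Cauchy-Schwarz is the origin of the constant \<open>1 + B\<^sup>2\<close>.\<close>

lemma nn_integral_abs_sum_le:
  fixes g :: "'i \<Rightarrow> 'a \<Rightarrow> real"
  assumes M: "\<And>i. prob_space (M i)" and "finite I"
    and g: "\<And>i. i \<in> I \<Longrightarrow> g i \<in> borel_measurable (M i)"
    and bound: "\<And>i y. i \<in> I \<Longrightarrow> y \<in> space (M i) \<Longrightarrow> \<bar>g i y\<bar> \<le> B"
    and mean: "\<And>i. i \<in> I \<Longrightarrow> (\<integral>y. g i y \<partial>M i) = 0"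
  shows "(\<integral>\<^sup>+x. ennreal \<bar>\<Sum>i\<in>I. g i (x i)\<bar> \<partial>PiM I M) \<le> ennreal ((1 + B\<^sup>2) * sqrt (card I))"
proof (cases "I = {}")
  case False
  interpret MI: prob_space "PiM I M" by (intro prob_space_PiM M)
  define s where "s = sqrt (card I)"
  have s: "s > 0" "s\<^sup>2 = card I" using False \<open>finite I\<close> by (auto simp: s_def card_gt_0_iff)
  have amgm: "\<bar>u\<bar> \<le> s + u\<^sup>2 / s" for u :: real
  proof -
    have "0 \<le> (\<bar>u\<bar> - s)\<^sup>2" by simp
    then have "\<bar>u\<bar> * s * 2 \<le> s\<^sup>2 + u\<^sup>2" by (simp add: power2_eq_square algebra_simps)
    moreover have "0 \<le> \<bar>u\<bar> * s" using s by simp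
    ultimately have "\<bar>u\<bar> * s \<le> s\<^sup>2 + u\<^sup>2" by linarith
    then show ?thesis using s(1) by (simp add: field_simps power2_eq_square)
  qed
  have gi [measurable]: "(\<lambda>x. g i (x i)) \<in> borel_measurable (PiM I M)" if "i \<in> I" for i
    using g[OF that] that by measurable
  have "(\<integral>\<^sup>+x. ennreal \<bar>\<Sum>i\<in>I. g i (x i)\<bar> \<partial>PiM I M)
      \<le> (\<integral>\<^sup>+x. ennreal s + ennreal (1 / s) * ennreal ((\<Sum>i\<in>I. g i (x i))\<^sup>2) \<partial>PiM I M)"
  proof (intro nn_integral_mono)
    fix x
    show "ennreal \<bar>\<Sum>i\<in>I. g i (x i)\<bar> \<le> ennreal s + ennreal (1 / s) * ennreal ((\<Sum>i\<in>I. g i (x i))\<^sup>2)"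
      using ennreal_leI[OF amgm[of "\<Sum>i\<in>I. g i (x i)"]] s(1)
      by (simp add: ennreal_mult[symmetric] ennreal_plus[symmetric] del: ennreal_plus)
  qed
  also have "\<dots> = ennreal s + ennreal (1 / s) * (\<integral>\<^sup>+x. ennreal ((\<Sum>i\<in>I. g i (x i))\<^sup>2) \<partial>PiM I M)"
    by (subst nn_integral_add) (auto simp: MI.emeasure_space_1 nn_integral_cmult)
  also have "\<dots> \<le> ennreal s + ennreal (1 / s) * ennreal (real (card I) * B\<^sup>2)"
    using nn_integral_sum_square_le[OF M \<open>finite I\<close> g bound mean] by (intro add_left_mono mult_left_mono) auto
  also have "\<dots> = ennreal ((1 + B\<^sup>2) * s)"
  proof -
    have "1 / s * (real (card I) * B\<^sup>2) = B\<^sup>2 * s"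
      using s(1) unfolding s(2)[symmetric] by (simp add: power2_eq_square)
    then show ?thesis
      using s(1) by (simp add: ennreal_mult[symmetric] ennreal_plus[symmetric] algebra_simps del: ennreal_plus)
  qed
  finally show ?thesis by (simp add: s_def)
qed simp

subsection \<open>Post-change drift\<close>

lemma cdf_in_unit: "real_distribution P \<Longrightarrow> cdf P y \<in> {0..1}"
  using finite_borel_measure.cdf_nonneg[OF real_distribution.finite_borel_measure_M]
    real_distribution.cdf_bounded_prob by auto

lemma borel_measurable_cdf: "real_distribution P \<Longrightarrow> cdf P \<in> borel_measurable borel"
  by (intro borel_measurable_mono monoI
      finite_borel_measure.cdf_nondecreasing[OF real_distribution.finite_borel_measure_M])

text \<open>Without an atom at \<open>y\<close> the CDF equals the mass strictly below
  \<open>y\<close>, and the tie term integrates to 0 for every \<open>v\<close>. This centres each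
  comparison with a pre-change observation.\<close>

lemma integral_below_plus_tie_minus_cdf:
  assumes "real_distribution P" "measure P {y} = 0"
  shows "(\<integral>z. of_bool (z < y) + v * of_bool (z = y) - cdf P y \<partial>P) = 0"
proof -
  interpret real_distribution P by fact
  have [simp]: "integrable P (indicator {..<y} :: real \<Rightarrow> real)" "integrable P (indicator {y} :: real \<Rightarrow> real)"
    by (auto intro!: integrable_const_bound[where B=1])
  have eq: "of_bool (z < y) = (indicator {..<y} z :: real)" "of_bool (z = y) = (indicator {y} z :: real)" for z
    by (auto simp: indicator_def)
  have "cdf P y = prob {..<y} + prob {y}"
    unfolding cdf_def by (subst finite_measure_Union[symmetric]) (auto intro!: arg_cong[where f=prob])
  moreover have "(\<integral>z. indicator {..<y} z + v * indicator {y} z - cdf P y \<partial>P)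
      = prob {..<y} + v * prob {y} - cdf P y"
    using prob_space by simp
  ultimately show ?thesis using assms(2) by (simp add: eq)
qed

text \<open>The difference is an average of \<open>j\<close> comparisons \<open>\<xi> i\<close>,
  each in [-1,1]. The first \<open>T\<close> are kept as a sum whose cancellation is exploited
  later; the others, at most \<open>r\<close> of them and including the self-tie, are bounded by 1
  each. Dividing by \<open>j\<close>, which exceeds \<open>T\<close>, gives the two terms.\<close>

lemma conf_pval_minus_cdf_le:
  assumes P: "real_distribution P" and "1 \<le> T" and j: "j \<in> {Suc T..T + r}" and lj: "l j \<in> {0..1}"
  shows "\<bar>conf_pval (x, l) j - cdf P (x j)\<bar>
    \<le> 1 / real T * \<bar>\<Sum>i=1..T. of_bool (x i < x j) + l j * of_bool (x i = x j) - cdf P (x j)\<bar> + real r / real T"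
proof -
  define \<xi> where "\<xi> i = of_bool (x i < x j) + l j * of_bool (x i = x j) - cdf P (x j)" for i
  have F: "cdf P (x j) \<in> {0..1}" by (rule cdf_in_unit[OF P])
  have \<xi>1: "\<bar>\<xi> i\<bar> \<le> 1" for i using F lj by (auto simp: \<xi>_def of_bool_def)
  have "(\<Sum>i=1..j. \<xi> i) = (\<Sum>i=1..j. of_bool (x i < x j)) + l j * (\<Sum>i=1..j. of_bool (x i = x j)) - real j * cdf P (x j)"
    unfolding \<xi>_def sum_subtractf sum.distrib sum_distrib_left[symmetric] by simp
  then have "conf_pval (x, l) j - cdf P (x j) = 1 / real j * (\<Sum>i=1..j. \<xi> i)"
    using j by (simp add: conf_pval_def field_simps)
  also have "{1..j} = {1..T} \<union> {Suc T..j}" using j by auto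
  also have "(\<Sum>i\<in>{1..T} \<union> {Suc T..j}. \<xi> i) = (\<Sum>i=1..T. \<xi> i) + (\<Sum>i=Suc T..j. \<xi> i)"
    by (rule sum.union_disjoint) auto
  finally have "\<bar>conf_pval (x, l) j - cdf P (x j)\<bar> = 1 / real j * \<bar>(\<Sum>i=1..T. \<xi> i) + (\<Sum>i=Suc T..j. \<xi> i)\<bar>"
    by (simp add: abs_mult)
  also have "\<dots> \<le> 1 / real T * (\<bar>\<Sum>i=1..T. \<xi> i\<bar> + real r)"
  proof (rule mult_mono)
    have "\<bar>\<Sum>i=Suc T..j. \<xi> i\<bar> \<le> (\<Sum>i=Suc T..j. \<bar>\<xi> i\<bar>)" by (rule sum_abs)
    also have "\<dots> \<le> (\<Sum>i=Suc T..j. 1)" by (intro sum_mono \<xi>1)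
    also have "\<dots> \<le> real r" using j by simp
    finally show "\<bar>(\<Sum>i=1..T. \<xi> i) + (\<Sum>i=Suc T..j. \<xi> i)\<bar> \<le> \<bar>\<Sum>i=1..T. \<xi> i\<bar> + real r" by linarith
    show "1 / real j \<le> 1 / real T" using j \<open>1 \<le> T\<close> by (intro divide_left_mono) auto
  qed auto
  also have "\<dots> = 1 / real T * \<bar>\<Sum>i=1..T. \<xi> i\<bar> + real r / real T" by (simp add: add_divide_distrib)
  finally show ?thesis unfolding \<xi>_def .
qed

text \<open>The term \<open>2 / sqrt T\<close> is the first moment bound with \<open>B = 1\<close>
  for \<open>T\<close> summands, \<open>(1 + 1) * sqrt T\<close>, divided by
  \<open>T\<close>.\<close>

lemma nn_integral_conf_pval_minus_cdf_le:
  assumes P0: "real_distribution P0" "\<And>x. measure P0 {x} = 0" and P1: "real_distribution P1"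
    and "1 \<le> T" and j: "j \<in> {Suc T..T + r}" and lj: "l j \<in> {0..1}"
  shows "(\<integral>\<^sup>+x. ennreal \<bar>conf_pval (x, l) j - cdf P0 (x j)\<bar> \<partial>PiM {1..} (obs_law P0 T P1))
    \<le> ennreal (2 / sqrt T + real r / real T)"
proof -
  let ?M = "obs_law P0 T P1" and ?I = "{1..T}"
  let ?J = "insert j ?I"
  define g where "g y z = of_bool (z < y) + l j * of_bool (z = y) - cdf P0 y" for y z :: real
  interpret P0: real_distribution P0 by fact
  interpret P1: real_distribution P1 by fact
  have M: "prob_space (?M i)" and setsM: "sets (?M i) = sets borel" for i
    by (auto intro: prob_space_obs_law simp: P0.prob_space_axioms P1.prob_space_axioms obs_law_def)
  interpret M: prob_space "?M i" for i by (rule M)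
  interpret PM: product_sigma_finite ?M ..
  interpret X: prob_space "PiM {1..} ?M" by (intro prob_space_PiM M)
  have jI: "j \<notin> ?I" using j by auto
  note borel_measurable_cdf[OF P0(1), measurable]
  have [measurable]: "(\<lambda>x. x i) \<in> borel_measurable (PiM K ?M)" if "i \<in> K" for i K
    using setsM that by (intro measurable_component_borel[where f="\<lambda>x. x" and M="?M" and I=K]) auto
  have g_meas [measurable]: "(\<lambda>\<omega>. g (yy \<omega>) (zz \<omega>)) \<in> borel_measurable N"
    if [measurable]: "yy \<in> borel_measurable N" "zz \<in> borel_measurable N" for N :: "'c measure" and yy zz
    unfolding g_def of_bool_def by measurable
  have sum_meas: "(\<lambda>x. ennreal \<bar>\<Sum>i\<in>?I. g (x j) (x i)\<bar>) \<in> borel_measurable (PiM K ?M)" if "?J \<subseteq> K" for K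
    using that by (auto intro!: borel_measurable_abs borel_measurable_sum)
  have "(\<integral>\<^sup>+x. ennreal \<bar>\<Sum>i\<in>?I. g (x j) (x i)\<bar> \<partial>PiM {1..} ?M)
      = (\<integral>\<^sup>+x. ennreal \<bar>\<Sum>i\<in>?I. g (restrict x ?J j) (restrict x ?J i)\<bar> \<partial>PiM {1..} ?M)"
    by (intro nn_integral_cong arg_cong[where f=ennreal] arg_cong[where f=abs] sum.cong) auto
  also have "\<dots> = (\<integral>\<^sup>+x. ennreal \<bar>\<Sum>i\<in>?I. g (x j) (x i)\<bar> \<partial>PiM ?J ?M)"
    using j by (intro nn_integral_PiM_restrict[where g="\<lambda>x. ennreal \<bar>\<Sum>i\<in>?I. g (x j) (x i)\<bar>"] M sum_meas) auto
  \<comment> \<open>Observation \<open>j\<close> lies outside the pre-change block; as the outer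
    variable it becomes a fixed level \<open>y\<close>, and the inner sum has independent summands
    of mean 0.\<close>
  also have "\<dots> = (\<integral>\<^sup>+y. \<integral>\<^sup>+x. ennreal \<bar>\<Sum>i\<in>?I. g ((x(j := y)) j) ((x(j := y)) i)\<bar> \<partial>PiM ?I ?M \<partial>?M j)"
    by (rule PM.product_nn_integral_insert_rev[OF _ jI sum_meas]) auto
  also have "\<dots> = (\<integral>\<^sup>+y. \<integral>\<^sup>+x. ennreal \<bar>\<Sum>i\<in>?I. g y (x i)\<bar> \<partial>PiM ?I ?M \<partial>?M j)"
    using jI by (intro nn_integral_cong arg_cong[where f=ennreal] arg_cong[where f=abs] sum.cong) auto
  also have "\<dots> \<le> (\<integral>\<^sup>+y. ennreal (2 * sqrt T) \<partial>?M j)"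
  proof (intro nn_integral_mono)
    fix y
    have "(\<integral>\<^sup>+x. ennreal \<bar>\<Sum>i\<in>?I. g y (x i)\<bar> \<partial>PiM ?I ?M) \<le> ennreal ((1 + 1\<^sup>2) * sqrt (card ?I))"
    proof (rule nn_integral_abs_sum_le[OF M])
      show "(\<lambda>z. g y z) \<in> borel_measurable (?M i)" for i
        using setsM[of i] by (auto intro!: g_meas simp: measurable_ident_sets)
      show "\<bar>g y z\<bar> \<le> 1" for z
        using cdf_in_unit[OF P0(1), of y] lj by (auto simp: g_def of_bool_def)
      show "(\<integral>z. g y z \<partial>?M i) = 0" if "i \<in> ?I" for i
        using integral_below_plus_tie_minus_cdf[OF P0] that by (simp add: g_def obs_law_def)
    qed auto
    then show "(\<integral>\<^sup>+x. ennreal \<bar>\<Sum>i\<in>?I. g y (x i)\<bar> \<partial>PiM ?I ?M) \<le> ennreal (2 * sqrt T)" by simp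
  qed
  also have "\<dots> = ennreal (2 * sqrt T)" by (simp add: M.emeasure_space_1)
  finally have sum_le: "(\<integral>\<^sup>+x. ennreal \<bar>\<Sum>i\<in>?I. g (x j) (x i)\<bar> \<partial>PiM {1..} ?M) \<le> ennreal (2 * sqrt T)" .
  have "(\<integral>\<^sup>+x. ennreal \<bar>conf_pval (x, l) j - cdf P0 (x j)\<bar> \<partial>PiM {1..} ?M)
      \<le> (\<integral>\<^sup>+x. ennreal (1 / real T) * ennreal \<bar>\<Sum>i\<in>?I. g (x j) (x i)\<bar> + ennreal (real r / real T) \<partial>PiM {1..} ?M)"
  proof (intro nn_integral_mono)
    fix x :: "nat \<Rightarrow> real"
    show "ennreal \<bar>conf_pval (x, l) j - cdf P0 (x j)\<bar>
      \<le> ennreal (1 / real T) * ennreal \<bar>\<Sum>i\<in>?I. g (x j) (x i)\<bar> + ennreal (real r / real T)"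
      using ennreal_leI[OF conf_pval_minus_cdf_le[where l=l and x=x, OF P0(1) \<open>1 \<le> T\<close> j lj]]
      by (simp add: g_def ennreal_mult[symmetric] ennreal_plus[symmetric] del: ennreal_plus)
  qed
  also have "\<dots> = ennreal (1 / real T) * (\<integral>\<^sup>+x. ennreal \<bar>\<Sum>i\<in>?I. g (x j) (x i)\<bar> \<partial>PiM {1..} ?M) + ennreal (real r / real T)"
  proof -
    have m: "(\<lambda>x. ennreal \<bar>\<Sum>i\<in>?I. g (x j) (x i)\<bar>) \<in> borel_measurable (PiM {1..} ?M)"
      using j by (intro sum_meas) auto
    show ?thesis
      by (subst nn_integral_add)
         (simp_all only: nn_integral_cmult[OF m] nn_integral_const X.emeasure_space_1 mult_1_right
           borel_measurable_const borel_measurable_times_ennreal m)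
  qed
  also have "\<dots> \<le> ennreal (1 / real T) * ennreal (2 * sqrt T) + ennreal (real r / real T)"
    by (intro add_right_mono mult_left_mono sum_le) auto
  also have "\<dots> = ennreal (2 / sqrt T + real r / real T)"
  proof -
    have "1 / real T * (2 * sqrt T) = 2 / sqrt T"
      using \<open>1 \<le> T\<close> by (simp add: real_div_sqrt field_simps)
    then show ?thesis by (simp add: ennreal_mult[symmetric] ennreal_plus[symmetric] del: ennreal_plus)
  qed
  finally show ?thesis .
qed

lemma nn_integral_abs_post_change_sum_le:
  assumes P0: "prob_space P0" and P1: "prob_space P1"
    and \<psi>: "\<psi> \<in> borel_measurable P1" and bound: "\<And>y. \<bar>\<psi> y\<bar> \<le> B" and mean: "(\<integral>y. \<psi> y \<partial>P1) = 0"
  shows "(\<integral>\<^sup>+x. ennreal \<bar>\<Sum>j=Suc T..T + r. \<psi> (x j)\<bar> \<partial>PiM {1..} (obs_law P0 T P1))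
    \<le> ennreal ((1 + B\<^sup>2) * sqrt r)"
proof -
  let ?J = "{Suc T..T + r}" and ?M = "obs_law P0 T P1"
  have M: "prob_space (?M i)" for i using P0 P1 by (rule prob_space_obs_law)
  have \<psi>M: "\<psi> \<in> borel_measurable (?M i)" if "i \<in> ?J" for i using that \<psi> by (simp add: obs_law_def)
  have [measurable]: "(\<lambda>x. \<psi> (x i)) \<in> borel_measurable (PiM ?J ?M)" if "i \<in> ?J" for i
    using \<psi>M[OF that] that by measurable
  have "(\<integral>\<^sup>+x. ennreal \<bar>\<Sum>j\<in>?J. \<psi> (x j)\<bar> \<partial>PiM {1..} ?M)
      = (\<integral>\<^sup>+x. ennreal \<bar>\<Sum>j\<in>?J. \<psi> (restrict x ?J j)\<bar> \<partial>PiM {1..} ?M)"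
    by simp
  also have "\<dots> = (\<integral>\<^sup>+x. ennreal \<bar>\<Sum>j\<in>?J. \<psi> (x j)\<bar> \<partial>PiM ?J ?M)"
    by (intro nn_integral_PiM_restrict[where g="\<lambda>x. ennreal \<bar>\<Sum>j\<in>?J. \<psi> (x j)\<bar>"] M) auto
  also have "\<dots> \<le> ennreal ((1 + B\<^sup>2) * sqrt (card ?J))"
    using \<psi>M bound mean by (intro nn_integral_abs_sum_le[OF M]) (auto simp: obs_law_def)
  finally show ?thesis by simp
qed

text \<open>Markov's inequality for a bound \<open>W\<close> on the shortfall below
  \<open>r * D\<close>. The first term is the Lipschitz cost of replacing each p-value by
  \<open>cdf P0 (x j)\<close>; the second is the fluctuation of the resulting i.i.d. sum, of order
  sqrt r against the allowance \<open>\<epsilon> * r\<close>. The factor \<open>2 * K\<close> bounds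
  \<phi> - D, since D is a mean of \<phi> and so is itself bounded by \<open>K\<close>.\<close>

lemma low_post_change_llr:
  fixes \<phi> :: "real \<Rightarrow> real"
  assumes P0: "real_distribution P0" "\<And>x. measure P0 {x} = 0" and P1: "real_distribution P1"
    and \<phi>: "\<phi> \<in> borel_measurable unif01" and lip: "L-lipschitz_on {0..1} \<phi>"
    and K: "\<And>z. z \<in> {0..1} \<Longrightarrow> \<bar>\<phi> z\<bar> \<le> K"
    and D: "(\<integral>y. \<phi> (cdf P0 y) \<partial>P1) = D" and "1 \<le> T" "1 \<le> r" "0 < \<epsilon>"
  shows "emeasure (row_law P0 T P1) {\<omega> \<in> space (row_law P0 T P1).
       (\<Sum>j=Suc T..T + r. \<phi> (conf_pval \<omega> j)) < real r * (D - \<epsilon>)}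
    \<le> ennreal (L * (2 / sqrt T + real r / real T) / \<epsilon> + (1 + (2 * K)\<^sup>2) / (\<epsilon> * sqrt r))"
    (is "emeasure ?R ?B \<le> _")
proof -
  let ?J = "{Suc T..T + r}" and ?M = "obs_law P0 T P1"
  let ?V = "PiM {1..} (\<lambda>_::nat. unif01)"
  interpret P0: real_distribution P0 by fact
  interpret P1: real_distribution P1 by fact
  interpret X: prob_space "PiM {1..} ?M"
    by (intro prob_space_PiM prob_space_obs_law P0.prob_space_axioms P1.prob_space_axioms)
  interpret V: prob_space ?V by (intro prob_space_PiM prob_space_unif01)
  have setsM: "sets (?M i) = sets borel" for i by (simp add: obs_law_def)
  have L: "0 \<le> L" by (rule lipschitz_on_nonneg[OF lip])
  have F_meas: "cdf P0 \<in> P1 \<rightarrow>\<^sub>M unif01"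
    using borel_measurable_cdf[OF P0(1)] cdf_in_unit[OF P0(1)]
    by (intro measurable_unif01I) (auto simp: measurable_cong_sets[OF P1.events_eq_borel refl])
  have \<phi>F: "(\<lambda>y. \<phi> (cdf P0 y)) \<in> borel_measurable P1" by (rule measurable_compose[OF F_meas \<phi>])
  have \<phi>F_bd: "\<bar>\<phi> (cdf P0 y)\<bar> \<le> K" for y using K cdf_in_unit[OF P0(1)] by blast
  have \<phi>F_int: "integrable P1 (\<lambda>y. \<phi> (cdf P0 y))"
    using \<phi>F \<phi>F_bd by (intro P1.integrable_const_bound[where B=K]) auto
  have "\<bar>D\<bar> \<le> K"
  proof -
    have "\<bar>D\<bar> \<le> (\<integral>y. \<bar>\<phi> (cdf P0 y)\<bar> \<partial>P1)" unfolding D[symmetric] by (rule integral_abs_bound)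
    also have "\<dots> \<le> (\<integral>y. K \<partial>P1)" using \<phi>F_int \<phi>F_bd by (intro integral_mono) auto
    finally show ?thesis using P1.prob_space by simp
  qed
  define \<psi> where "\<psi> y = \<phi> (cdf P0 y) - D" for y
  have \<psi>_meas: "\<psi> \<in> borel_measurable P1" using \<phi>F by (simp add: \<psi>_def[abs_def])
  have \<psi>_mean: "(\<integral>y. \<psi> y \<partial>P1) = 0" using \<phi>F_int D P1.prob_space by (simp add: \<psi>_def)
  have \<psi>_bd: "\<bar>\<psi> y\<bar> \<le> 2 * K" for y using \<phi>F_bd[of y] \<open>\<bar>D\<bar> \<le> K\<close> by (simp add: \<psi>_def)
  have [measurable]: "(\<lambda>\<omega>. \<phi> (conf_pval \<omega> j)) \<in> borel_measurable ?R" if "j \<in> ?J" for j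
    using that by (intro measurable_compose[OF measurable_conf_pval_row_law \<phi>]) auto
  have B_sets: "?B \<in> sets ?R" by measurable
  define W where "W x l = (\<Sum>j\<in>?J. L * \<bar>conf_pval (x, l) j - cdf P0 (x j)\<bar>) + \<bar>\<Sum>j\<in>?J. \<psi> (x j)\<bar>" for x l
  \<comment> \<open>Markov's inequality in pointwise form: on the bad event the shortfall exceeds
    \<open>\<epsilon> * r\<close>, and \<open>W\<close> dominates the shortfall.\<close>
  have ind_le: "indicator ?B (x, l) \<le> ennreal (1 / (\<epsilon> * r)) * ennreal (W x l)" if l: "l \<in> space ?V" for x l
  proof (cases "(x, l) \<in> ?B")
    case True
    have lj: "l j \<in> {0..1}" if "j \<in> ?J" for j using l that by (auto simp: space_PiM PiE_iff)
    have "\<phi> (cdf P0 (x j)) - \<phi> (conf_pval (x, l) j) \<le> L * \<bar>conf_pval (x, l) j - cdf P0 (x j)\<bar>" if "j \<in> ?J" for j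
    proof -
      have "conf_pval (x, l) j \<in> {0..1}" using that lj[OF that] by (intro conf_pval_range) auto
      then show ?thesis
        using lipschitz_onD[OF lip _ cdf_in_unit[OF P0(1), of "x j"]] by (fastforce simp: dist_real_def)
    qed
    then have "(\<Sum>j\<in>?J. \<phi> (cdf P0 (x j)) - \<phi> (conf_pval (x, l) j)) \<le> (\<Sum>j\<in>?J. L * \<bar>conf_pval (x, l) j - cdf P0 (x j)\<bar>)"
      by (rule sum_mono)
    moreover have "(\<Sum>j\<in>?J. \<psi> (x j)) = (\<Sum>j\<in>?J. \<phi> (cdf P0 (x j))) - real r * D"
      by (simp add: \<psi>_def sum_subtractf)
    ultimately have "real r * D - (\<Sum>j\<in>?J. \<phi> (conf_pval (x, l) j)) \<le> W x l"
      unfolding W_def sum_subtractf by linarith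
    then have "\<epsilon> * r \<le> W x l" using True by (simp add: algebra_simps)
    then have "1 \<le> 1 / (\<epsilon> * r) * W x l" using \<open>0 < \<epsilon>\<close> \<open>1 \<le> r\<close> by (simp add: field_simps)
    then show ?thesis
      using True \<open>0 < \<epsilon>\<close> \<open>1 \<le> r\<close> by (subst ennreal_mult'[symmetric]) auto
  qed simp
  have "emeasure ?R ?B = (\<integral>\<^sup>+\<omega>. indicator ?B \<omega> \<partial>?R)" using B_sets by simp
  also have "\<dots> = (\<integral>\<^sup>+l. \<integral>\<^sup>+x. indicator ?B (x, l) \<partial>PiM {1..} ?M \<partial>?V)"
    using B_sets by (intro nn_integral_row_law P0.prob_space_axioms P1.prob_space_axioms) auto
  also have "\<dots> \<le> (\<integral>\<^sup>+l. ennreal (L * (2 / sqrt T + real r / real T) / \<epsilon> + (1 + (2 * K)\<^sup>2) / (\<epsilon> * sqrt r)) \<partial>?V)"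
  proof (intro nn_integral_mono)
    fix l assume l: "l \<in> space ?V"
    have lj: "l j \<in> {0..1}" if "1 \<le> j" for j using l that by (auto simp: space_PiM PiE_iff)
    have comp: "(\<lambda>x. x i) \<in> borel_measurable (PiM {1..} ?M)" if "1 \<le> i" for i
      using setsM that by (intro measurable_component_borel[where f="\<lambda>x. x" and M="?M" and I="{1..}"]) auto
    have [measurable]: "(\<lambda>x. conf_pval (x, l) j) \<in> borel_measurable (PiM {1..} ?M)" if "j \<in> ?J" for j
      using that by (intro borel_measurable_conf_pval comp) auto
    have [measurable]: "(\<lambda>x. cdf P0 (x j)) \<in> borel_measurable (PiM {1..} ?M)" if "j \<in> ?J" for j
      using that by (intro measurable_compose[OF comp borel_measurable_cdf[OF P0(1)]]) auto
    have [measurable]: "(\<lambda>x. \<psi> (x j)) \<in> borel_measurable (PiM {1..} ?M)" if "j \<in> ?J" for j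
      using \<psi>_meas that measurable_cong_sets[OF P1.events_eq_borel refl, of borel]
      by (intro measurable_compose[OF comp]) auto
    have "(\<integral>\<^sup>+x. ennreal (W x l) \<partial>PiM {1..} ?M)
        = (\<Sum>j\<in>?J. ennreal L * (\<integral>\<^sup>+x. ennreal \<bar>conf_pval (x, l) j - cdf P0 (x j)\<bar> \<partial>PiM {1..} ?M))
          + (\<integral>\<^sup>+x. ennreal \<bar>\<Sum>j\<in>?J. \<psi> (x j)\<bar> \<partial>PiM {1..} ?M)"
    proof -
      have "ennreal (W x l) = (\<Sum>j\<in>?J. ennreal L * ennreal \<bar>conf_pval (x, l) j - cdf P0 (x j)\<bar>)
          + ennreal \<bar>\<Sum>j\<in>?J. \<psi> (x j)\<bar>" for x
        unfolding W_def using L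
        by (simp add: sum_nonneg ennreal_mult[symmetric] sum_ennreal)
      then show ?thesis
        by (simp add: nn_integral_add nn_integral_sum nn_integral_cmult del: One_nat_def)
    qed
    also have "\<dots> \<le> (\<Sum>j\<in>?J. ennreal L * ennreal (2 / sqrt T + real r / real T)) + ennreal ((1 + (2 * K)\<^sup>2) * sqrt r)"
    proof (intro add_mono sum_mono mult_left_mono)
      show "(\<integral>\<^sup>+x. ennreal \<bar>conf_pval (x, l) j - cdf P0 (x j)\<bar> \<partial>PiM {1..} ?M)
        \<le> ennreal (2 / sqrt T + real r / real T)" if "j \<in> ?J" for j
        using that lj by (intro nn_integral_conf_pval_minus_cdf_le P0 P1 \<open>1 \<le> T\<close>) auto
      show "(\<integral>\<^sup>+x. ennreal \<bar>\<Sum>j\<in>?J. \<psi> (x j)\<bar> \<partial>PiM {1..} ?M) \<le> ennreal ((1 + (2 * K)\<^sup>2) * sqrt r)"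
        by (intro nn_integral_abs_post_change_sum_le P0.prob_space_axioms P1.prob_space_axioms \<psi>_meas \<psi>_bd \<psi>_mean)
    qed auto
    also have "\<dots> = ennreal (real r * (L * (2 / sqrt T + real r / real T)) + (1 + (2 * K)\<^sup>2) * sqrt r)"
      using L by (simp add: ennreal_mult[symmetric] ennreal_plus[symmetric] ennreal_of_nat_eq_real_of_nat del: ennreal_plus)
    finally have W_le: "(\<integral>\<^sup>+x. ennreal (W x l) \<partial>PiM {1..} ?M)
      \<le> ennreal (real r * (L * (2 / sqrt T + real r / real T)) + (1 + (2 * K)\<^sup>2) * sqrt r)" .
    have [measurable]: "(\<lambda>x. W x l) \<in> borel_measurable (PiM {1..} ?M)" unfolding W_def by measurable
    have "(\<integral>\<^sup>+x. indicator ?B (x, l) \<partial>PiM {1..} ?M) \<le> (\<integral>\<^sup>+x. ennreal (1 / (\<epsilon> * r)) * ennreal (W x l) \<partial>PiM {1..} ?M)"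
      by (intro nn_integral_mono ind_le l)
    also have "\<dots> = ennreal (1 / (\<epsilon> * r)) * (\<integral>\<^sup>+x. ennreal (W x l) \<partial>PiM {1..} ?M)"
      by (rule nn_integral_cmult) measurable
    also have "\<dots> \<le> ennreal (1 / (\<epsilon> * r)) * ennreal (real r * (L * (2 / sqrt T + real r / real T)) + (1 + (2 * K)\<^sup>2) * sqrt r)"
      by (intro mult_left_mono W_le) auto
    also have "\<dots> = ennreal (1 / (\<epsilon> * r) * (real r * (L * (2 / sqrt T + real r / real T)) + (1 + (2 * K)\<^sup>2) * sqrt r))"
      using \<open>0 < \<epsilon>\<close> by (subst ennreal_mult'[symmetric]) auto
    also have "1 / (\<epsilon> * r) * (real r * (L * (2 / sqrt T + real r / real T)) + (1 + (2 * K)\<^sup>2) * sqrt r)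
        = L * (2 / sqrt T + real r / real T) / \<epsilon> + (1 + (2 * K)\<^sup>2) / (\<epsilon> * sqrt r)"
    proof -
      define u where "u = sqrt r"
      have u: "u > 0" "real r = u * u" using \<open>1 \<le> r\<close> by (auto simp: u_def)
      define v where "v = L * (2 / sqrt T + real r / real T)"
      have "1 / (\<epsilon> * (u * u)) * ((u * u) * v + (1 + (2 * K)\<^sup>2) * u) = v / \<epsilon> + (1 + (2 * K)\<^sup>2) / (\<epsilon> * u)"
        using u(1) \<open>0 < \<epsilon>\<close> by (simp add: field_simps)
      then show ?thesis unfolding v_def u_def[symmetric] u(2)[symmetric] .
    qed
    finally show "(\<integral>\<^sup>+x. indicator ?B (x, l) \<partial>PiM {1..} ?M)
      \<le> ennreal (L * (2 / sqrt T + real r / real T) / \<epsilon> + (1 + (2 * K)\<^sup>2) / (\<epsilon> * sqrt r))" .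
  qed
  finally show ?thesis by (simp only: nn_integral_const V.emeasure_space_1 mult_1_right)
qed

subsection \<open>Detection delay\<close>

text \<open>A nonempty set of naturals attains its infimum, so the passage time is either infinite
  or a genuine first hit.\<close>

lemma first_passage_cases:
  obtains (never) "first_passage s b = \<infinity>" "\<And>t. 1 \<le> t \<Longrightarrow> \<not> ennreal b \<le> s t"
  | (hit) m where "first_passage s b = enat m" "1 \<le> m" "ennreal b \<le> s m"
      "\<And>t. 1 \<le> t \<Longrightarrow> ennreal b \<le> s t \<Longrightarrow> m \<le> t"
proof (cases "\<exists>t. 1 \<le> t \<and> ennreal b \<le> s t")
  case True
  define m where "m = (LEAST t. 1 \<le> t \<and> ennreal b \<le> s t)"
  have m: "1 \<le> m \<and> ennreal b \<le> s m" unfolding m_def by (rule LeastI_ex[OF True])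
  have least: "m \<le> t" if "1 \<le> t" "ennreal b \<le> s t" for t
    unfolding m_def using that by (intro Least_le) auto
  have "first_passage s b = enat m"
    unfolding first_passage_def using m least by (intro antisym INF_lower INF_greatest) auto
  with m least show ?thesis by (intro hit[of m]) blast+
next
  case False
  then have "{t. 1 \<le> t \<and> ennreal b \<le> s t} = {}" by blast
  then have "first_passage s b = \<infinity>"
    unfolding first_passage_def by (simp only: image_empty Inf_empty top_enat_def)
  with False show ?thesis by (intro never) blast+
qed

text \<open>Trading the passage time for the existence of a crossing makes the event visibly
  measurable and reduces detection to exhibiting a single crossing.\<close>

lemma first_passage_le_iff:
  "ereal_of_enat (first_passage s b) \<le> ereal y \<longleftrightarrow> (\<exists>t\<ge>1. real t \<le> y \<and> ennreal b \<le> s t)"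
  by (cases rule: first_passage_cases[of s b]) force+

lemma less_first_passage_iff:
  "enat m < first_passage s b \<longleftrightarrow> \<not> (\<exists>t\<in>{1..m}. ennreal b \<le> s t)"
  by (cases rule: first_passage_cases[of s b]) force+

lemma Z_stat_le_S_stat: "1 \<le> t \<Longrightarrow> Z_stat Q f w p t \<le> S_stat Q f w p t"
  unfolding Z_stat_def S_stat_def by (auto intro!: member_le_sum)

lemma ln_ennreal_ge_imp: "ereal y \<le> ln_ennreal x \<Longrightarrow> ennreal (exp y) \<le> x"
proof (cases x)
  case (real r)
  assume *: "ereal y \<le> ln_ennreal x"
  then have "r > 0" using real by (auto simp: ln_ennreal_def split: if_splits)
  then have "y \<le> ln r" using * real by (simp add: ln_ennreal_def)
  then have "exp y \<le> r" using \<open>r > 0\<close> by (simp add: ln_ge_iff)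
  then show ?thesis using real by (simp add: ennreal_leI)
qed simp

text \<open>Of all candidates in the maximum only \<open>k = Suc T\<close>, the first post-change
  time, is retained. Its mixture runs over exactly the \<open>r\<close> post-change p-values, and
  shifting indices by \<open>T\<close> brings it into the form of the support assumption.\<close>

lemma Z_stat_ge:
  assumes supp: "\<forall>r\<ge>1. \<forall>z :: nat \<Rightarrow> real. (\<forall>i\<in>{1..r}. z i \<in> {0..1}) \<longrightarrow>
           ln_ennreal (\<integral>\<^sup>+\<theta>. (\<Prod>i=1..r. ennreal (f \<theta> (z i))) \<partial>Q)
             \<ge> ereal ((\<Sum>i=1..r. ln (h (z i))) - a * ln (real r) - c)"
    and "1 \<le> r" and p: "\<And>j. j \<in> {Suc T..T + r} \<Longrightarrow> p j \<in> {0..1}"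
  shows "ennreal (w (Suc T)) * ennreal (exp ((\<Sum>j=Suc T..T + r. ln (h (p j))) - a * ln (real r) - c))
    \<le> Z_stat Q f w p (T + r)"
proof -
  have shift: "{Suc T..T + r} = {1 + T..r + T}" by auto
  have "mix_lik Q f (Suc T) (T + r) p = (\<integral>\<^sup>+\<theta>. (\<Prod>i=1..r. ennreal (f \<theta> (p (i + T)))) \<partial>Q)"
    unfolding mix_lik_def shift prod.shift_bounds_cl_nat_ivl ..
  moreover have "(\<Sum>j=Suc T..T + r. ln (h (p j))) = (\<Sum>i=1..r. ln (h (p (i + T))))"
    unfolding shift sum.shift_bounds_cl_nat_ivl ..
  moreover have "\<forall>i\<in>{1..r}. p (i + T) \<in> {0..1}" using p by auto
  ultimately have "ereal ((\<Sum>j=Suc T..T + r. ln (h (p j))) - a * ln (real r) - c)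
      \<le> ln_ennreal (mix_lik Q f (Suc T) (T + r) p)"
    using supp[rule_format, OF \<open>1 \<le> r\<close>, of "\<lambda>i. p (i + T)"] by simp
  then have "ennreal (w (Suc T)) * ennreal (exp ((\<Sum>j=Suc T..T + r. ln (h (p j))) - a * ln (real r) - c))
      \<le> ennreal (w (Suc T)) * mix_lik Q f (Suc T) (T + r) p"
    by (intro mult_left_mono ln_ennreal_ge_imp) auto
  also have "\<dots> \<le> Z_stat Q f w p (T + r)"
    unfolding Z_stat_def using \<open>1 \<le> r\<close> by (intro Max_ge) auto
  finally show ?thesis .
qed

section \<open>Growth conditions on the delay\<close>

lemma eventually_log_delay_suffices:
  fixes \<eta> A d a b :: real
  assumes "0 < A" "0 \<le> a" "0 \<le> d" "1 + \<eta> < A * d" "0 \<le> \<eta>"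
  shows "\<forall>\<^sub>F T in sequentially. 1 \<le> nat \<lfloor>A * ln (real T)\<rfloor> \<and>
    b \<le> - (1 + \<eta>) * ln (real (Suc T)) + real (nat \<lfloor>A * ln (real T)\<rfloor>) * d - a * ln (real (nat \<lfloor>A * ln (real T)\<rfloor>))"
proof -
  \<comment> \<open>\<delta> is the surplus per unit of ln T: the drift \<open>A * d\<close> earned
    minus the exponent of the weight. Being positive, it eventually beats the ln ln T term and all
    constants.\<close>
  define \<delta> where "\<delta> = A * d - (1 + \<eta>)"
  have "\<delta> > 0" using assms by (simp add: \<delta>_def)
  \<comment> \<open>The coefficient \<open>a + 1\<close> in place of \<open>a\<close> stays positive
    even when \<open>a = 0\<close>. Of the constants added below, the one with \<open>ln 2\<close>
    pays for \<open>Suc T\<close> being at most \<open>2 * T\<close>, and \<open>d\<close> pays for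
    rounding the delay down.\<close>
  have lim: "filterlim (\<lambda>x::real. \<delta> * ln x - (a + 1) * ln (A * ln x)) at_top at_top"
    using \<open>\<delta> > 0\<close> \<open>0 < A\<close> \<open>0 \<le> a\<close> by real_asymp
  have lim': "filterlim (\<lambda>x::real. A * ln x) at_top at_top" using \<open>0 < A\<close> by real_asymp
  have "\<forall>\<^sub>F x in at_top. b + (1 + \<eta>) * ln 2 + d \<le> \<delta> * ln x - (a + 1) * ln (A * ln x) \<and> 1 \<le> A * ln x \<and> 1 \<le> (x::real)"
    using lim lim' by (intro eventually_conj eventually_ge_at_top) (auto simp: filterlim_at_top)
  then have "\<forall>\<^sub>F T in sequentially. b + (1 + \<eta>) * ln 2 + d \<le> \<delta> * ln (real T) - (a + 1) * ln (A * ln (real T))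
      \<and> 1 \<le> A * ln (real T) \<and> 1 \<le> real T"
    by (rule eventually_compose_filterlim[OF _ filterlim_real_sequentially])
  then show ?thesis
  proof eventually_elim
    case (elim T)
    define r where "r = nat \<lfloor>A * ln (real T)\<rfloor>"
    have r: "1 \<le> r" "real r \<le> A * ln (real T)" "A * ln (real T) - 1 \<le> real r"
      using elim unfolding r_def by linarith+
    have "ln (real (Suc T)) \<le> ln (2 * real T)" using elim by (subst ln_le_cancel_iff) auto
    then have "ln (real (Suc T)) \<le> ln 2 + ln (real T)" using elim by (simp add: ln_mult)
    then have "(1 + \<eta>) * ln (real (Suc T)) \<le> (1 + \<eta>) * (ln 2 + ln (real T))"
      using assms by (intro mult_left_mono) auto
    moreover have "(A * ln (real T) - 1) * d \<le> real r * d" using r assms by (intro mult_right_mono) auto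
    moreover have "a * ln (real r) \<le> (a + 1) * ln (A * ln (real T))"
      using r assms by (intro mult_mono) auto
    moreover have "\<delta> * ln (real T) = A * ln (real T) * d - (1 + \<eta>) * ln (real T)"
      by (simp add: \<delta>_def algebra_simps)
    ultimately show ?case using elim r(1) unfolding r_def[symmetric] by (simp add: algebra_simps)
  qed
qed

text \<open>The delay faces opposite demands: it must diverge, so that fluctuations average out, and
  be negligible against \<open>T\<close>, so that post-change data do not contaminate the reference
  sample. A multiple of ln T meets both.\<close>

lemma miss_bound_tendsto_0:
  fixes A L B \<epsilon> :: real
  assumes "0 < A"
  shows "(\<lambda>T. L * (2 / sqrt (real T) + real (nat \<lfloor>A * ln (real T)\<rfloor>) / real T) / \<epsilon>
      + B / (\<epsilon> * sqrt (real (nat \<lfloor>A * ln (real T)\<rfloor>)))) \<longlonglongrightarrow> 0"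
proof -
  define r where "r T = real (nat \<lfloor>A * ln (real T)\<rfloor>)" for T :: nat
  have r_top: "filterlim r at_top sequentially"
  proof (rule filterlim_at_top_mono)
    show "filterlim (\<lambda>T::nat. A * ln (real T) - 1) at_top sequentially" using assms by real_asymp
    show "\<forall>\<^sub>F T in sequentially. A * ln (real T) - 1 \<le> r T"
      unfolding r_def by (intro always_eventually allI) linarith
  qed
  have 1: "(\<lambda>T. r T / real T) \<longlonglongrightarrow> 0"
  proof (rule tendsto_sandwich[where f="\<lambda>_. 0"])
    show "(\<lambda>T::nat. A * ln (real T) / real T) \<longlonglongrightarrow> 0" by real_asymp
    show "\<forall>\<^sub>F T in sequentially. r T / real T \<le> A * ln (real T) / real T"
      using eventually_ge_at_top[of "1::nat"]
    proof eventually_elim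
      case (elim T)
      then have "0 \<le> A * ln (real T)" using assms by simp
      then have "r T \<le> A * ln (real T)" unfolding r_def by linarith
      then show ?case by (intro divide_right_mono) auto
    qed
  qed (auto simp: r_def)
  have 2: "(\<lambda>T. inverse (sqrt (r T))) \<longlonglongrightarrow> 0"
    by (intro tendsto_inverse_0_at_top filterlim_compose[OF sqrt_at_top r_top])
  have 3: "(\<lambda>T::nat. 2 / sqrt (real T)) \<longlonglongrightarrow> 0" by real_asymp
  have "(\<lambda>T. L * (2 / sqrt (real T) + r T / real T) / \<epsilon> + B / \<epsilon> * inverse (sqrt (r T)))
      \<longlonglongrightarrow> L * (0 + 0) * inverse \<epsilon> + B / \<epsilon> * 0"
    unfolding divide_inverse[of _ \<epsilon>] by (intro tendsto_intros 1 2 3)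
  then show ?thesis unfolding r_def by (simp add: field_simps)
qed

text \<open>\<open>D\<close> stands for detection by the deadline and \<open>N\<close> for no alarm
  up to the change. Discarding false alarms costs at most \<alpha> in the joint probability, and
  conditioning divides by at least \<open>1 - \<alpha>\<close>, which is positive.\<close>

lemma detection_conclusions:
  fixes M :: "nat \<Rightarrow> 'a measure" and D N :: "nat \<Rightarrow> 'a \<Rightarrow> bool"
  assumes M: "\<And>n. prob_space (M n)"
    and D_meas: "\<And>n. Measurable.pred (M n) (D n)" and N_meas: "\<And>n. Measurable.pred (M n) (N n)"
    and det: "(\<lambda>n. \<P>(\<omega> in M n. D n \<omega>)) \<longlonglongrightarrow> 1"
    and safe: "\<And>n. \<P>(\<omega> in M n. \<not> N n \<omega>) \<le> \<alpha>" and "\<alpha> < 1"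
  shows "liminf (\<lambda>n. ereal (\<P>(\<omega> in M n. N n \<omega> \<and> D n \<omega>))) \<ge> ereal (1 - \<alpha>)"
    and "(\<lambda>n. \<P>(\<omega> in M n. \<not> D n \<omega> \<bar> N n \<omega>)) \<longlonglongrightarrow> 0"
proof -
  note [measurable] = D_meas N_meas
  have compl: "\<P>(\<omega> in M n. \<not> P \<omega>) = 1 - \<P>(\<omega> in M n. P \<omega>)" if "Measurable.pred (M n) P" for n P
    using prob_space.prob_neg[OF M[of n], of P] that by simp
  have N_ge: "1 - \<alpha> \<le> \<P>(\<omega> in M n. N n \<omega>)" for n using safe[of n] compl[OF N_meas] by simp
  have ND_ge: "\<P>(\<omega> in M n. D n \<omega>) - \<alpha> \<le> \<P>(\<omega> in M n. N n \<omega> \<and> D n \<omega>)" for n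
  proof -
    interpret prob_space "M n" by (rule M)
    have "\<P>(\<omega> in M n. D n \<omega>) \<le> prob ({\<omega>\<in>space (M n). N n \<omega> \<and> D n \<omega>} \<union> {\<omega>\<in>space (M n). \<not> N n \<omega>})"
      by (intro finite_measure_mono) auto
    also have "\<dots> \<le> \<P>(\<omega> in M n. N n \<omega> \<and> D n \<omega>) + \<P>(\<omega> in M n. \<not> N n \<omega>)"
      by (intro measure_Un_le) auto
    finally show ?thesis using safe[of n] by linarith
  qed
  have "(\<lambda>n. ereal (\<P>(\<omega> in M n. D n \<omega>) - \<alpha>)) \<longlonglongrightarrow> ereal (1 - \<alpha>)"
    by (intro tendsto_intros det)
  then have "ereal (1 - \<alpha>) = liminf (\<lambda>n. ereal (\<P>(\<omega> in M n. D n \<omega>) - \<alpha>))"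
    by (rule lim_imp_Liminf[symmetric, rotated]) simp
  also have "\<dots> \<le> liminf (\<lambda>n. ereal (\<P>(\<omega> in M n. N n \<omega> \<and> D n \<omega>)))"
    using ND_ge by (intro Liminf_mono always_eventually) auto
  finally show "liminf (\<lambda>n. ereal (\<P>(\<omega> in M n. N n \<omega> \<and> D n \<omega>))) \<ge> ereal (1 - \<alpha>)" .
  show "(\<lambda>n. \<P>(\<omega> in M n. \<not> D n \<omega> \<bar> N n \<omega>)) \<longlonglongrightarrow> 0"
  proof (rule tendsto_sandwich[where f="\<lambda>_. 0"])
    have "(\<lambda>n. (1 - \<P>(\<omega> in M n. D n \<omega>)) / (1 - \<alpha>)) \<longlonglongrightarrow> (1 - 1) / (1 - \<alpha>)"
      using \<open>\<alpha> < 1\<close> by (intro tendsto_intros det) auto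
    then show "(\<lambda>n. (1 - \<P>(\<omega> in M n. D n \<omega>)) / (1 - \<alpha>)) \<longlonglongrightarrow> 0" by simp
    show "\<forall>\<^sub>F n in sequentially. \<P>(\<omega> in M n. \<not> D n \<omega> \<bar> N n \<omega>) \<le> (1 - \<P>(\<omega> in M n. D n \<omega>)) / (1 - \<alpha>)"
    proof (intro always_eventually allI)
      fix n
      interpret prob_space "M n" by (rule M)
      have "\<P>(\<omega> in M n. \<not> D n \<omega> \<and> N n \<omega>) \<le> \<P>(\<omega> in M n. \<not> D n \<omega>)"
        by (intro finite_measure_mono) auto
      also have "\<dots> = 1 - \<P>(\<omega> in M n. D n \<omega>)" by (rule compl) simp
      finally show "\<P>(\<omega> in M n. \<not> D n \<omega> \<bar> N n \<omega>) \<le> (1 - \<P>(\<omega> in M n. D n \<omega>)) / (1 - \<alpha>)"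
        unfolding cond_prob_def using N_ge[of n] \<open>\<alpha> < 1\<close> by (intro frac_le) auto
    qed
  qed (auto simp: cond_prob_def)
qed

text \<open>Identifies the drift. With base e the divergence is the mean of ln h under
  \<open>pit_law\<close>, which is the image of \<open>P1\<close> under \<open>cdf P0\<close>; a
  change of variables expresses it by one post-change observation.\<close>

lemma KL_divergence_pit_law:
  assumes P0: "real_distribution P0" and P1: "real_distribution P1"
    and h: "h \<in> borel_measurable unif01" "\<forall>z\<in>{0..1}. 0 < h z"
    and dens: "density unif01 (\<lambda>z. ennreal (h z)) = pit_law P0 P1"
  shows "KL_divergence (exp 1) unif01 (pit_law P0 P1) = (\<integral>y. ln (h (cdf P0 y)) \<partial>P1)"
proof -
  interpret U: prob_space unif01 by (rule prob_space_unif01)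
  have F_meas: "cdf P0 \<in> P1 \<rightarrow>\<^sub>M unif01"
    using borel_measurable_cdf[OF P0] cdf_in_unit[OF P0]
    by (intro measurable_unif01I) (auto simp: measurable_cong_sets[OF real_distribution.events_eq_borel[OF P1] refl])
  have pos: "AE z in unif01. 0 \<le> h z" using h(2) by (intro AE_I2) (auto simp: less_imp_le)
  have ln_h: "(\<lambda>z. ln (h z)) \<in> borel_measurable unif01" using h(1) by measurable
  have "KL_divergence (exp 1) unif01 (pit_law P0 P1) = (\<integral>z. h z * log (exp 1) (h z) \<partial>unif01)"
    unfolding dens[symmetric] using h(1) pos by (intro U.KL_density) auto
  also have "\<dots> = (\<integral>z. ln (h z) \<partial>pit_law P0 P1)"
    unfolding dens[symmetric] using h(1) pos ln_h by (subst integral_density) (auto simp: log_ln)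
  also have "\<dots> = (\<integral>y. ln (h (cdf P0 y)) \<partial>P1)"
    unfolding pit_law_def by (rule integral_distr[OF F_meas ln_h])
  finally show ?thesis .
qed

text \<open>Stated for any \<open>s\<close> above \<open>Z_stat\<close>, so that one proof serves
  both detectors, and along all changepoints \<open>T\<close> rather than a given sequence, so that
  the rows of the array enter afterwards by composing limits.\<close>

lemma detection_probability:
  fixes s :: "(nat \<Rightarrow> real) \<Rightarrow> nat \<Rightarrow> ennreal"
  assumes P0: "real_distribution P0" "\<And>x. measure P0 {x} = 0" and P1: "real_distribution P1"
    and \<phi>: "(\<lambda>z. ln (h z)) \<in> borel_measurable unif01"
    and lip: "L-lipschitz_on {0..1} (\<lambda>z. ln (h z))"
    and K: "\<And>z. z \<in> {0..1} \<Longrightarrow> \<bar>ln (h z)\<bar> \<le> K"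
    and D: "(\<integral>y. ln (h (cdf P0 y)) \<partial>P1) = D" "0 < D"
    and supp: "\<forall>r\<ge>1. \<forall>z :: nat \<Rightarrow> real. (\<forall>i\<in>{1..r}. z i \<in> {0..1}) \<longrightarrow>
           ln_ennreal (\<integral>\<^sup>+\<theta>. (\<Prod>i=1..r. ennreal (f \<theta> (z i))) \<partial>Q)
             \<ge> ereal ((\<Sum>i=1..r. ln (h (z i))) - a * ln (real r) - c)"
    and "0 \<le> a" "0 < \<eta>" and w: "\<And>k. 1 \<le> k \<Longrightarrow> w k = C * real k powr (- (1 + \<eta>))" and "0 < C"
    and "0 < \<alpha>" and A: "(1 + \<eta>) / D < A"
    and Z_le: "\<And>p t. 1 \<le> t \<Longrightarrow> Z_stat Q f w p t \<le> s p t"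
    and s_meas: "\<And>T t. (\<lambda>\<omega>. s (conf_pval \<omega>) t) \<in> borel_measurable (row_law P0 T P1)"
  shows "(\<lambda>T. \<P>(\<omega> in row_law P0 T P1. \<exists>t\<ge>1. real t \<le> real T + A * ln (real T) \<and>
            ennreal (1 / \<alpha>) \<le> s (conf_pval \<omega>) t)) \<longlonglongrightarrow> 1"
proof (rule tendsto_sandwich)
  interpret P0: real_distribution P0 by fact
  interpret P1: real_distribution P1 by fact
  have A_pos: "0 < A" using A \<open>0 < \<eta>\<close> \<open>0 < D\<close> by (auto intro: le_less_trans[of 0 "(1 + \<eta>) / D"])
  \<comment> \<open>\<open>u\<close> is the drift at which a delay of A ln T just pays for the
    weight, and the assumption on \<open>A\<close> says \<open>u < D\<close>. The midpoint
    \<open>d\<close> leaves room on both sides: \<open>d > u\<close> pays with a surplus, and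
    \<epsilon> = D - d is the tolerated loss of drift.\<close>
  define u where "u = (1 + \<eta>) / A"
  define d where "d = (D + u) / 2"
  define \<epsilon> where "\<epsilon> = D - d"
  have "u < D" using A A_pos \<open>0 < D\<close> by (simp add: u_def field_simps)
  moreover have "0 < u" using A_pos \<open>0 < \<eta>\<close> by (simp add: u_def)
  ultimately have d: "0 \<le> d" "u < d" "0 < \<epsilon>" by (auto simp: d_def \<epsilon>_def)
  then have Ad: "1 + \<eta> < A * d" using A_pos by (simp add: u_def field_simps)
  define r where "r T = nat \<lfloor>A * ln (real T)\<rfloor>" for T :: nat
  define \<delta> where "\<delta> T = L * (2 / sqrt (real T) + real (r T) / real T) / \<epsilon>
      + (1 + (2 * K)\<^sup>2) / (\<epsilon> * sqrt (real (r T)))" for T :: nat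
  have \<delta>_lim: "\<delta> \<longlonglongrightarrow> 0" unfolding \<delta>_def r_def using A_pos by (rule miss_bound_tendsto_0)
  from tendsto_diff[OF tendsto_const \<delta>_lim, of 1] show "(\<lambda>T. 1 - \<delta> T) \<longlonglongrightarrow> 1" by simp
  \<comment> \<open>The threshold in logarithmic form, with the level \<open>1 / \<alpha>\<close>,
    the normalising constant \<open>C\<close> of the weights and the remainder \<open>c\<close>
    collected on the left.\<close>
  have "\<forall>\<^sub>F T in sequentially. 1 \<le> r T \<and> ln (1 / \<alpha>) - ln C + c \<le>
      - (1 + \<eta>) * ln (real (Suc T)) + real (r T) * d - a * ln (real (r T))"
    unfolding r_def using A_pos \<open>0 \<le> a\<close> d(1) Ad \<open>0 < \<eta>\<close>
    by (intro eventually_log_delay_suffices) auto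
  then show "\<forall>\<^sub>F T in sequentially. 1 - \<delta> T \<le> \<P>(\<omega> in row_law P0 T P1.
      \<exists>t\<ge>1. real t \<le> real T + A * ln (real T) \<and> ennreal (1 / \<alpha>) \<le> s (conf_pval \<omega>) t)"
    using eventually_ge_at_top[of "1::nat"]
  proof eventually_elim
    case (elim T)
    let ?R = "row_law P0 T P1" and ?J = "{Suc T..T + r T}"
    interpret R: prob_space ?R
      by (intro prob_space_row_law P0.prob_space_axioms P1.prob_space_axioms)
    let ?hit = "\<lambda>\<omega>. \<exists>t\<ge>1. real t \<le> real T + A * ln (real T) \<and> ennreal (1 / \<alpha>) \<le> s (conf_pval \<omega>) t"
    let ?low = "\<lambda>\<omega>. (\<Sum>j\<in>?J. ln (h (conf_pval \<omega> j))) < real (r T) * (D - \<epsilon>)"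
    note [measurable] = s_meas[where T=T]
    have hit_meas: "Measurable.pred ?R ?hit" by measurable
    have \<delta>_nonneg: "0 \<le> \<delta> T"
      using d(3) lipschitz_on_nonneg[OF lip] by (auto simp: \<delta>_def intro!: add_nonneg_nonneg)
    have hit: "?hit \<omega>" if \<omega>: "\<omega> \<in> space ?R" "\<not> ?low \<omega>" for \<omega>
    \<comment> \<open>The witness is the last integer time before the deadline expires, which leaves
      the most post-change data.\<close>
    proof (intro exI[of _ "T + r T"] conjI)
      have "0 \<le> A * ln (real T)" using A_pos elim by simp
      then show "real (T + r T) \<le> real T + A * ln (real T)" unfolding r_def by linarith
      show "1 \<le> T + r T" using elim by simp
      obtain x l where xl: "\<omega> = (x, l)" by (cases \<omega>)
      have p01: "conf_pval \<omega> j \<in> {0..1}" if "j \<in> ?J" for j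
        using \<omega>(1) that unfolding xl
        by (intro conf_pval_range) (auto simp: row_law_eq space_pair_measure space_PiM PiE_iff)
      let ?e = "(\<Sum>j\<in>?J. ln (h (conf_pval \<omega> j))) - a * ln (real (r T)) - c"
      \<comment> \<open>In exponential form the weight joins the exponent \<open>?e\<close>, so the
        claim becomes the logarithmic inequality secured for large \<open>T\<close>.\<close>
      have wT: "w (Suc T) = exp (ln C + - (1 + \<eta>) * ln (real (Suc T)))"
        using \<open>0 < C\<close> by (simp add: w exp_add powr_def del: of_nat_Suc)
      have "ln (1 / \<alpha>) \<le> ln C + - (1 + \<eta>) * ln (real (Suc T)) + ?e"
        using elim \<omega>(2) by (simp add: \<epsilon>_def del: of_nat_Suc)
      then have "exp (ln (1 / \<alpha>)) \<le> exp (ln C + - (1 + \<eta>) * ln (real (Suc T)) + ?e)"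
        by simp
      then have "1 / \<alpha> \<le> w (Suc T) * exp ?e"
        unfolding wT exp_add[symmetric] using \<open>0 < \<alpha>\<close> by simp
      then have "ennreal (1 / \<alpha>) \<le> ennreal (w (Suc T)) * ennreal (exp ?e)"
        using wT by (simp add: ennreal_mult[symmetric] ennreal_leI)
      also have "\<dots> \<le> Z_stat Q f w (conf_pval \<omega>) (T + r T)"
        using elim p01 by (intro Z_stat_ge[OF supp]) auto
      also have "\<dots> \<le> s (conf_pval \<omega>) (T + r T)" using elim by (intro Z_le) simp
      finally show "ennreal (1 / \<alpha>) \<le> s (conf_pval \<omega>) (T + r T)" .
    qed
    have low_sets: "{\<omega> \<in> space ?R. ?low \<omega>} \<in> sets ?R"
    proof -
      have [measurable]: "(\<lambda>\<omega>. ln (h (conf_pval \<omega> j))) \<in> borel_measurable ?R" if "j \<in> ?J" for j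
        using that by (intro measurable_compose[OF measurable_conf_pval_row_law \<phi>]) auto
      show ?thesis by measurable
    qed
    have "emeasure ?R {\<omega> \<in> space ?R. ?low \<omega>} \<le> ennreal (\<delta> T)"
      unfolding \<delta>_def using elim by (intro low_post_change_llr P0 P1 \<phi> lip K D(1) d(3)) auto
    then have "R.prob {\<omega> \<in> space ?R. ?low \<omega>} \<le> \<delta> T"
      using \<delta>_nonneg by (simp add: R.emeasure_eq_measure)
    moreover have "1 - R.prob {\<omega> \<in> space ?R. ?low \<omega>} = R.prob (space ?R - {\<omega> \<in> space ?R. ?low \<omega>})"
      using low_sets by (simp only: R.prob_compl)
    moreover have "\<dots> \<le> R.prob {\<omega> \<in> space ?R. ?hit \<omega>}"
      using hit hit_meas by (intro R.finite_measure_mono) auto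
    ultimately show "1 - \<delta> T \<le> R.prob {\<omega> \<in> space ?R. ?hit \<omega>}" by linarith
  qed
  show "\<forall>\<^sub>F T in sequentially. \<P>(\<omega> in row_law P0 T P1. \<exists>t\<ge>1. real t \<le> real T + A * ln (real T) \<and>
      ennreal (1 / \<alpha>) \<le> s (conf_pval \<omega>) t) \<le> 1"
    by (intro always_eventually allI prob_space.prob_le_1 prob_space_row_law
        P0.prob_space_axioms P1.prob_space_axioms)
qed simp

theorem corollary3p6:
  fixes T :: "nat \<Rightarrow> nat"
    and P0 P1 :: "real measure"
    and Q :: "'t measure"
    and f :: "'t \<Rightarrow> real \<Rightarrow> real"
    and h :: "real \<Rightarrow> real"
    and w :: "nat \<Rightarrow> real"
    and a c \<eta> \<alpha> A :: real
  assumes "mono_on {1..} T" and "\<forall>n\<ge>1. 1 \<le> T n" and "filterlim T at_top sequentially"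
    and "prob_space P0" and "sets P0 = sets borel"
    and "prob_space P1" and "sets P1 = sets borel"
    and "prob_space Q" and "density_family Q f"
    and "continuous_on UNIV (cdf P0)"
    and "continuous_on {0..1} (pit_cdf P0 P1)"
    and "pit_cdf P0 P1 0 = 0"
    and "(SUP t\<in>{0..1}. \<bar>pit_cdf P0 P1 t - t\<bar>) > 0"
    and "absolutely_continuous unif01 (pit_law P0 P1)"
    and "h \<in> borel_measurable unif01" and "\<forall>z\<in>{0..1}. 0 < h z"
    and "density unif01 (\<lambda>z. ennreal (h z)) = pit_law P0 P1"
    and "integrable (pit_law P0 P1) (entropy_density (exp 1) unif01 (pit_law P0 P1))"
    and "0 < KL_divergence (exp 1) unif01 (pit_law P0 P1)"
    and "bounded ((\<lambda>z. ln (h z)) ` {0..1})"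
    and "\<exists>L. L-lipschitz_on {0..1} (\<lambda>z. ln (h z))"
    and "0 \<le> a" and "0 \<le> c"
    and "\<forall>r\<ge>1. \<forall>z :: nat \<Rightarrow> real. (\<forall>i\<in>{1..r}. z i \<in> {0..1}) \<longrightarrow>
           ln_ennreal (\<integral>\<^sup>+\<theta>. (\<Prod>i=1..r. ennreal (f \<theta> (z i))) \<partial>Q)
             \<ge> ereal ((\<Sum>i=1..r. ln (h (z i))) - a * ln (real r) - c)"
    and "0 < \<eta>"
    and "\<exists>C. \<forall>k\<ge>1. w k = C * real k powr (- (1 + \<eta>))"
    and "0 < (\<Sum>k. w (Suc k))" and "(\<Sum>k. w (Suc k)) \<le> 1"
    and "0 < \<alpha>" and "\<alpha> < 1"
    and "A > (1 + \<eta>) / KL_divergence (exp 1) unif01 (pit_law P0 P1)"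
  shows "\<forall>\<tau>\<in>{tau_Z Q f w (1 / \<alpha>), tau_S Q f w (1 / \<alpha>)}.
      (\<lambda>n. \<P>(\<omega> in row_law P0 (T n) P1.
          ereal_of_enat (\<tau> \<omega>) \<le> ereal (real (T n) + A * ln (real (T n))))) \<longlonglongrightarrow> 1
    \<and> liminf (\<lambda>n. ereal (\<P>(\<omega> in row_law P0 (T n) P1.
          enat (T n) < \<tau> \<omega> \<and> ereal_of_enat (\<tau> \<omega>) \<le> ereal (real (T n) + A * ln (real (T n))))))
        \<ge> ereal (1 - \<alpha>)
    \<and> (\<lambda>n. \<P>(\<omega> in row_law P0 (T n) P1.
          ereal_of_enat (\<tau> \<omega>) > ereal (real (T n) + A * ln (real (T n))) \<bar> \<tau> \<omega> > enat (T n))) \<longlonglongrightarrow> 0"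
proof -
  interpret P0: prob_space P0 by fact
  interpret P1: prob_space P1 by fact
  have P0: "real_distribution P0" and P1: "real_distribution P1"
    using assms(5,7) by unfold_locales auto
  \<comment> \<open>Continuity of the CDF at a point says that the point has no mass; this makes
    pre-change ties null.\<close>
  have atomless: "measure P0 {x} = 0" for x
    using assms(10) finite_borel_measure.isCont_cdf[OF real_distribution.finite_borel_measure_M[OF P0]]
    by (simp add: continuous_on_eq_continuous_at)
  have \<phi>: "(\<lambda>z. ln (h z)) \<in> borel_measurable unif01" using assms(15) by measurable
  obtain K where "\<forall>v\<in>(\<lambda>z. ln (h z)) ` {0..1}. norm v \<le> K"
    using assms(20) unfolding bounded_iff by blast
  then have K: "\<bar>ln (h z)\<bar> \<le> K" if "z \<in> {0..1}" for z using that by simp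
  obtain L where L: "L-lipschitz_on {0..1} (\<lambda>z. ln (h z))" using assms(21) by blast
  define D where "D = KL_divergence (exp 1) unif01 (pit_law P0 P1)"
  have D: "(\<integral>y. ln (h (cdf P0 y)) \<partial>P1) = D" "0 < D"
    using KL_divergence_pit_law[OF P0 P1 assms(15-17)] assms(19) by (simp_all add: D_def)
  obtain C where C: "\<And>k. 1 \<le> k \<Longrightarrow> w k = C * real k powr (- (1 + \<eta>))" using assms(26) by blast
  have summable: "summable (\<lambda>k. real (Suc k) powr (- (1 + \<eta>)))"
    using assms(25) by (subst summable_Suc_iff) (simp add: summable_real_powr_iff)
  have w_Suc: "w (Suc k) = C * real (Suc k) powr (- (1 + \<eta>))" for k by (rule C) simp
  have "(\<Sum>k. w (Suc k)) = C * (\<Sum>k. real (Suc k) powr (- (1 + \<eta>)))"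
    unfolding w_Suc using summable by (rule suminf_mult)
  moreover have "0 \<le> (\<Sum>k. real (Suc k) powr (- (1 + \<eta>)))"
    using summable by (intro suminf_nonneg) auto
  \<comment> \<open>The series multiplying \<open>C\<close> is nonnegative, so the positive total
    weight forces \<open>C\<close> to be positive.\<close>
  ultimately have "0 < C" using assms(27) by (auto simp: zero_less_mult_iff)
  have w_nonneg: "0 \<le> w k" if "1 \<le> k" for k using C[OF that] \<open>0 < C\<close> by simp
  have w_sum: "(\<Sum>k=1..m. w k) \<le> 1" for m
  proof -
    have "(\<Sum>k=1..m. w k) = (\<Sum>k<m. w (Suc k))"
      using sum.atLeast1_atMost_eq[of w m] by simp
    also have "\<dots> \<le> (\<Sum>k. w (Suc k))"
      using summable \<open>0 < C\<close> unfolding w_Suc by (intro sum_le_suminf summable_mult) auto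
    finally show ?thesis using assms(28) by simp
  qed
  let ?R = "\<lambda>n. row_law P0 (T n) P1"
  let ?y = "\<lambda>n. real (T n) + A * ln (real (T n))"
  \<comment> \<open>\<open>s\<close> is sandwiched between the two statistics: the lower bound gives
    timely detection, the upper bound the false alarm control. The two detectors are the extreme
    cases.\<close>
  have main: "(\<lambda>n. \<P>(\<omega> in ?R n. ereal_of_enat (\<tau> \<omega>) \<le> ereal (?y n))) \<longlonglongrightarrow> 1
    \<and> liminf (\<lambda>n. ereal (\<P>(\<omega> in ?R n. enat (T n) < \<tau> \<omega> \<and> ereal_of_enat (\<tau> \<omega>) \<le> ereal (?y n)))) \<ge> ereal (1 - \<alpha>)
    \<and> (\<lambda>n. \<P>(\<omega> in ?R n. ereal_of_enat (\<tau> \<omega>) > ereal (?y n) \<bar> \<tau> \<omega> > enat (T n))) \<longlonglongrightarrow> 0"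
    if \<tau>: "\<tau> = (\<lambda>\<omega>. first_passage (s (conf_pval \<omega>)) (1 / \<alpha>))"
      and Z_le: "\<And>p t. 1 \<le> t \<Longrightarrow> Z_stat Q f w p t \<le> s p t"
      and le_S: "\<And>p t. 1 \<le> t \<Longrightarrow> s p t \<le> S_stat Q f w p t"
      and s_meas: "\<And>T t. (\<lambda>\<omega>. s (conf_pval \<omega>) t) \<in> borel_measurable (row_law P0 T P1)"
    for \<tau> and s :: "(nat \<Rightarrow> real) \<Rightarrow> nat \<Rightarrow> ennreal"
  proof -
    note [measurable] = s_meas
    let ?D = "\<lambda>n \<omega>. ereal_of_enat (\<tau> \<omega>) \<le> ereal (?y n)" and ?N = "\<lambda>n \<omega>. enat (T n) < \<tau> \<omega>"
    have R: "prob_space (?R n)" for n by (intro prob_space_row_law assms)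
    have D_meas: "Measurable.pred (?R n) (?D n)" for n
      unfolding \<tau> first_passage_le_iff by measurable
    have N_meas: "Measurable.pred (?R n) (?N n)" for n
      unfolding \<tau> less_first_passage_iff by measurable
    have det: "(\<lambda>n. \<P>(\<omega> in ?R n. ?D n \<omega>)) \<longlonglongrightarrow> 1"
    proof -
      have "(\<lambda>T. \<P>(\<omega> in row_law P0 T P1. \<exists>t\<ge>1. real t \<le> real T + A * ln (real T) \<and>
          ennreal (1 / \<alpha>) \<le> s (conf_pval \<omega>) t)) \<longlonglongrightarrow> 1"
        using assms(31) by (intro detection_probability[OF P0 atomless P1 \<phi> L K D assms(24,22,25) C \<open>0 < C\<close> assms(29) _ Z_le s_meas])
          (simp_all add: D_def)
      from filterlim_compose[OF this assms(3)] show ?thesis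
        unfolding \<tau> first_passage_le_iff .
    qed
    have safe: "\<P>(\<omega> in ?R n. \<not> ?N n \<omega>) \<le> \<alpha>" for n
    proof -
      interpret R: prob_space "?R n" by (rule R)
      have [measurable]: "(\<lambda>\<omega>. S_stat Q f w (conf_pval \<omega>) t) \<in> borel_measurable (?R n)" for t
        by (intro borel_measurable_S_row_law assms)
      have "R.prob {\<omega> \<in> space (?R n). \<not> ?N n \<omega>}
          \<le> R.prob {\<omega> \<in> space (?R n). \<exists>t\<in>{1..T n}. ennreal (1 / \<alpha>) \<le> S_stat Q f w (conf_pval \<omega>) t}"
        unfolding \<tau> less_first_passage_iff not_not
      proof (intro R.finite_measure_mono)
        show "{\<omega> \<in> space (?R n). \<exists>t\<in>{1..T n}. ennreal (1 / \<alpha>) \<le> s (conf_pval \<omega>) t}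
            \<subseteq> {\<omega> \<in> space (?R n). \<exists>t\<in>{1..T n}. ennreal (1 / \<alpha>) \<le> S_stat Q f w (conf_pval \<omega>) t}"
        proof (intro Collect_mono impI, elim conjE bexE)
          fix \<omega> t assume "\<omega> \<in> space (?R n)" "t \<in> {1..T n}" "ennreal (1 / \<alpha>) \<le> s (conf_pval \<omega>) t"
          then show "\<omega> \<in> space (?R n) \<and> (\<exists>t\<in>{1..T n}. ennreal (1 / \<alpha>) \<le> S_stat Q f w (conf_pval \<omega>) t)"
            by (intro conjI bexI[of _ t] order_trans[OF _ le_S]) auto
        qed
      qed measurable
      also have "\<dots> \<le> \<alpha>"
        using false_alarm_row_law[OF assms(4,5) atomless assms(6-9) w_nonneg w_sum assms(29), where T="T n"] assms(29)
        by (simp add: R.emeasure_eq_measure)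
      finally show ?thesis .
    qed
    show ?thesis
      using det detection_conclusions[OF R D_meas N_meas det safe assms(30)]
      by (simp only: not_le simp_thms)
  qed
  show ?thesis
  proof (intro ballI)
    fix \<tau> assume "\<tau> \<in> {tau_Z Q f w (1 / \<alpha>), tau_S Q f w (1 / \<alpha>)}"
    then consider (Z) "\<tau> = (\<lambda>\<omega>. first_passage (Z_stat Q f w (conf_pval \<omega>)) (1 / \<alpha>))"
      | (S) "\<tau> = (\<lambda>\<omega>. first_passage (S_stat Q f w (conf_pval \<omega>)) (1 / \<alpha>))"
      by (auto simp: tau_Z_def[abs_def] tau_S_def[abs_def])
    then show "(\<lambda>n. \<P>(\<omega> in row_law P0 (T n) P1.
          ereal_of_enat (\<tau> \<omega>) \<le> ereal (real (T n) + A * ln (real (T n))))) \<longlonglongrightarrow> 1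
    \<and> liminf (\<lambda>n. ereal (\<P>(\<omega> in row_law P0 (T n) P1.
          enat (T n) < \<tau> \<omega> \<and> ereal_of_enat (\<tau> \<omega>) \<le> ereal (real (T n) + A * ln (real (T n))))))
        \<ge> ereal (1 - \<alpha>)
    \<and> (\<lambda>n. \<P>(\<omega> in row_law P0 (T n) P1.
          ereal_of_enat (\<tau> \<omega>) > ereal (real (T n) + A * ln (real (T n))) \<bar> \<tau> \<omega> > enat (T n))) \<longlonglongrightarrow> 0"
    proof cases
      case Z
      then show ?thesis
        by (rule main)
          (assumption | rule order_refl Z_stat_le_S_stat borel_measurable_Z_row_law assms(5,7-9))+
    next
      case S
      then show ?thesis
        by (rule main)
          (assumption | rule order_refl Z_stat_le_S_stat borel_measurable_S_row_law assms(5,7-9))+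
    qed
  qed
qed

end
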